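(* Let $L$ be a finite bounded lattice (in the sense of McKenzie, i.e. both lower bounded and upper bounded). Then for each $\gamma\in\mathrm{Cov}(L)$ the poset $\mathrm{Cov}(L,\gamma)$ is a bounded lattice (in the same sense).
   Context: A finite lattice $L$ is lower bounded if there exist a finite set $X$ and a surjective lattice homomorphism $f:\mathcal{F}(X)\to L$ from the free lattice generated by $X$ such that, for each $y\in L$, the set $\{x\in\mathcal F(X) \mid y\le f(x)\}$ is either empty or has a least element. Upper bounded is the dual notion (i.e. the dual lattice $L^{op}$ is lower bounded); bounded means both lower bounded and upper bounded. For a poset $P$, $\mathrm{Cov}(P)$ is the set of covers: pairs $\gamma=(\gamma_0,\gamma_1)\in P^2$ with $\gamma_0<\gamma_1$ and no element strictly between them. For a finite lattice $L$, $\mathrm{Cov}(L)$ is partially ordered by: $\gamma\le\delta$ iff $\gamma_0\le\delta_0$, $\gamma_1\not\le\delta_0$ and $\gamma_1\le\delta_1$. For $\gamma\in\mathrm{Cov}(L)$, $\mathrm{Cov}(L,\gamma)$ denotes the connected component of $\gamma$ in the poset $\mathrm{Cov}(L)$ (connectedness with respect to the comparability relation), with the induced order. *)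

theory Defs
  imports "HOL-Algebra.Lattice"
begin

section \<open>Free lattices\<close>

datatype 'x lattice_term =
    Gen 'x
  | Join "'x lattice_term" "'x lattice_term"
  | Meet "'x lattice_term" "'x lattice_term"

definition terms_over :: "'x set \<Rightarrow> 'x lattice_term set"
  where "terms_over X = {t. set_lattice_term t \<subseteq> X}"

text \<open>The least preorder on the terms over \<open>X\<close> in which \<open>Join\<close> and \<open>Meet\<close> are binary
  suprema and infima, i.e. the inequalities between terms that hold in every lattice.\<close>

inductive term_le :: "'x set \<Rightarrow> 'x lattice_term \<Rightarrow> 'x lattice_term \<Rightarrow> bool" for X
where
  refl: "t \<in> terms_over X \<Longrightarrow> term_le X t t"
| trans: "\<lbrakk>term_le X s t; term_le X t u\<rbrakk> \<Longrightarrow> term_le X s u"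
| join_upper1: "\<lbrakk>s \<in> terms_over X; t \<in> terms_over X\<rbrakk> \<Longrightarrow> term_le X s (Join s t)"
| join_upper2: "\<lbrakk>s \<in> terms_over X; t \<in> terms_over X\<rbrakk> \<Longrightarrow> term_le X t (Join s t)"
| join_least: "\<lbrakk>term_le X s u; term_le X t u\<rbrakk> \<Longrightarrow> term_le X (Join s t) u"
| meet_lower1: "\<lbrakk>s \<in> terms_over X; t \<in> terms_over X\<rbrakk> \<Longrightarrow> term_le X (Meet s t) s"
| meet_lower2: "\<lbrakk>s \<in> terms_over X; t \<in> terms_over X\<rbrakk> \<Longrightarrow> term_le X (Meet s t) t"
| meet_greatest: "\<lbrakk>term_le X u s; term_le X u t\<rbrakk> \<Longrightarrow> term_le X u (Meet s t)"

definition term_equiv :: "'x set \<Rightarrow> ('x lattice_term \<times> 'x lattice_term) set"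
  where "term_equiv X = {(s, t). term_le X s t \<and> term_le X t s}"

definition free_lattice :: "'x set \<Rightarrow> 'x lattice_term set gorder"
  where "free_lattice X =
    \<lparr> carrier = terms_over X // term_equiv X,
      eq = (=),
      le = (\<lambda>A B. \<exists>s\<in>A. \<exists>t\<in>B. term_le X s t) \<rparr>"

definition free_class :: "'x set \<Rightarrow> 'x lattice_term \<Rightarrow> 'x lattice_term set"
  where "free_class X t = term_equiv X `` {t}"

text \<open>The lemmas below show that this is a lattice with the universal property of the
  free lattice on \<open>X\<close>.\<close>

lemma term_le_terms: "term_le X s t \<Longrightarrow> s \<in> terms_over X \<and> t \<in> terms_over X"
  by (induction rule: term_le.induct) (auto simp: terms_over_def)

lemma equiv_term_equiv: "equiv (terms_over X) (term_equiv X)"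
  unfolding equiv_def refl_on_def sym_on_def trans_on_def term_equiv_def
  by (auto dest: term_le_terms intro: term_le.refl term_le.trans)

lemma carrier_free_lattice: "carrier (free_lattice X) = free_class X ` terms_over X"
  by (auto simp: free_lattice_def free_class_def quotient_def)

lemma eq_free_lattice: "eq (free_lattice X) = (=)"
  by (simp add: free_lattice_def)

lemma free_class_mem: "s \<in> free_class X t \<longleftrightarrow> term_le X s t \<and> term_le X t s"
  by (auto simp: free_class_def term_equiv_def)

lemma le_free_class:
  assumes "s \<in> terms_over X" "t \<in> terms_over X"
  shows "free_class X s \<sqsubseteq>\<^bsub>free_lattice X\<^esub> free_class X t \<longleftrightarrow> term_le X s t"
proof
  assume "free_class X s \<sqsubseteq>\<^bsub>free_lattice X\<^esub> free_class X t"
  then obtain s' t' where "s' \<in> free_class X s" "t' \<in> free_class X t" "term_le X s' t'"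
    by (auto simp: free_lattice_def)
  then have "term_le X s s'" "term_le X s' t'" "term_le X t' t"
    by (simp_all add: free_class_mem)
  then show "term_le X s t" by (blast intro: term_le.trans)
next
  assume "term_le X s t"
  then show "free_class X s \<sqsubseteq>\<^bsub>free_lattice X\<^esub> free_class X t"
    using assms
    by (simp add: free_lattice_def)
      (rule bexI[of _ s], rule bexI[of _ t], simp_all add: free_class_mem term_le.refl)
qed

lemma free_class_eq_iff:
  assumes "s \<in> terms_over X" "t \<in> terms_over X"
  shows "free_class X s = free_class X t \<longleftrightarrow> term_le X s t \<and> term_le X t s"
  using eq_equiv_class_iff[OF equiv_term_equiv assms]
  by (simp add: free_class_def term_equiv_def)

lemma Join_terms: "Join s t \<in> terms_over X \<longleftrightarrow> s \<in> terms_over X \<and> t \<in> terms_over X"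
  by (auto simp: terms_over_def)

lemma Meet_terms: "Meet s t \<in> terms_over X \<longleftrightarrow> s \<in> terms_over X \<and> t \<in> terms_over X"
  by (auto simp: terms_over_def)

lemma Gen_terms: "Gen x \<in> terms_over X \<longleftrightarrow> x \<in> X"
  by (auto simp: terms_over_def)

lemma partial_order_free_lattice: "partial_order (free_lattice X)"
proof (unfold_locales, unfold eq_free_lattice carrier_free_lattice)
  fix A B
  assume "A \<sqsubseteq>\<^bsub>free_lattice X\<^esub> B" "B \<sqsubseteq>\<^bsub>free_lattice X\<^esub> A"
    "A \<in> free_class X ` terms_over X" "B \<in> free_class X ` terms_over X"
  then show "A = B" by (elim imageE) (simp add: le_free_class free_class_eq_iff)
next
  fix A B C
  assume "A \<sqsubseteq>\<^bsub>free_lattice X\<^esub> B" "B \<sqsubseteq>\<^bsub>free_lattice X\<^esub> C"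
    "A \<in> free_class X ` terms_over X" "B \<in> free_class X ` terms_over X"
    "C \<in> free_class X ` terms_over X"
  then show "A \<sqsubseteq>\<^bsub>free_lattice X\<^esub> C"
    by (elim imageE) (simp add: le_free_class, rule term_le.trans)
qed (auto simp: le_free_class intro: term_le.refl)

lemma least_free_lattice:
  assumes "s \<in> terms_over X" "t \<in> terms_over X"
  shows "least (free_lattice X) (free_class X (Join s t))
    (Upper (free_lattice X) {free_class X s, free_class X t})"
proof (rule least_UpperI)
  fix A assume "A \<in> {free_class X s, free_class X t}"
  then show "A \<sqsubseteq>\<^bsub>free_lattice X\<^esub> free_class X (Join s t)"
    using assms
    by (elim insertE emptyE)
      (simp_all add: le_free_class Join_terms term_le.join_upper1 term_le.join_upper2)
next
  fix A assume "A \<in> Upper (free_lattice X) {free_class X s, free_class X t}"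
  then have "A \<in> free_class X ` terms_over X"
    "free_class X s \<sqsubseteq>\<^bsub>free_lattice X\<^esub> A" "free_class X t \<sqsubseteq>\<^bsub>free_lattice X\<^esub> A"
    using assms by (simp_all add: Upper_def carrier_free_lattice)
  then show "free_class X (Join s t) \<sqsubseteq>\<^bsub>free_lattice X\<^esub> A"
    using assms by (elim imageE) (simp add: le_free_class Join_terms term_le.join_least)
qed (use assms in \<open>simp_all add: carrier_free_lattice Join_terms\<close>)

lemma greatest_free_lattice:
  assumes "s \<in> terms_over X" "t \<in> terms_over X"
  shows "greatest (free_lattice X) (free_class X (Meet s t))
    (Lower (free_lattice X) {free_class X s, free_class X t})"
proof (rule greatest_LowerI)
  fix A assume "A \<in> {free_class X s, free_class X t}"
  then show "free_class X (Meet s t) \<sqsubseteq>\<^bsub>free_lattice X\<^esub> A"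
    using assms
    by (elim insertE emptyE)
      (simp_all add: le_free_class Meet_terms term_le.meet_lower1 term_le.meet_lower2)
next
  fix A assume "A \<in> Lower (free_lattice X) {free_class X s, free_class X t}"
  then have "A \<in> free_class X ` terms_over X"
    "A \<sqsubseteq>\<^bsub>free_lattice X\<^esub> free_class X s" "A \<sqsubseteq>\<^bsub>free_lattice X\<^esub> free_class X t"
    using assms by (simp_all add: Lower_def carrier_free_lattice)
  then show "A \<sqsubseteq>\<^bsub>free_lattice X\<^esub> free_class X (Meet s t)"
    using assms by (elim imageE) (simp add: le_free_class Meet_terms term_le.meet_greatest)
qed (use assms in \<open>simp_all add: carrier_free_lattice Meet_terms\<close>)

lemma lattice_free_lattice: "lattice (free_lattice X)"
proof -
  interpret partial_order "free_lattice X" by (rule partial_order_free_lattice)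
  show ?thesis
    by (unfold_locales; unfold carrier_free_lattice)
      (elim imageE, simp, blast intro: least_free_lattice greatest_free_lattice)+
qed

lemma join_free_class:
  assumes "s \<in> terms_over X" "t \<in> terms_over X"
  shows "free_class X s \<squnion>\<^bsub>free_lattice X\<^esub> free_class X t = free_class X (Join s t)"
proof -
  interpret lattice "free_lattice X" by (rule lattice_free_lattice)
  show ?thesis unfolding join_def sup_def
    by (rule some_equality, rule least_free_lattice[OF assms])
      (rule weak_least_unique[unfolded eq_is_equal, OF _ least_free_lattice[OF assms]])
qed

lemma meet_free_class:
  assumes "s \<in> terms_over X" "t \<in> terms_over X"
  shows "free_class X s \<sqinter>\<^bsub>free_lattice X\<^esub> free_class X t = free_class X (Meet s t)"
proof -
  interpret lattice "free_lattice X" by (rule lattice_free_lattice)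
  show ?thesis unfolding meet_def inf_def
    by (rule some_equality, rule greatest_free_lattice[OF assms])
      (rule weak_greatest_unique[unfolded eq_is_equal, OF _ greatest_free_lattice[OF assms]])
qed

definition lattice_hom ::
  "('a, 'c) gorder_scheme \<Rightarrow> ('b, 'd) gorder_scheme \<Rightarrow> ('a \<Rightarrow> 'b) set"
  where "lattice_hom K L = {f \<in> carrier K \<rightarrow> carrier L. join_pres K L f \<and> meet_pres K L f}"

primrec term_eval :: "('a, 'c) gorder_scheme \<Rightarrow> ('x \<Rightarrow> 'a) \<Rightarrow> 'x lattice_term \<Rightarrow> 'a"
where
  "term_eval L g (Gen x) = g x"
| "term_eval L g (Join s t) = term_eval L g s \<squnion>\<^bsub>L\<^esub> term_eval L g t"
| "term_eval L g (Meet s t) = term_eval L g s \<sqinter>\<^bsub>L\<^esub> term_eval L g t"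

lemma term_eval_closed:
  assumes "lattice L" "g \<in> X \<rightarrow> carrier L" "t \<in> terms_over X"
  shows "term_eval L g t \<in> carrier L"
proof -
  interpret lattice L by fact
  show ?thesis using assms(2,3)
    by (induction t) (auto simp: Join_terms Meet_terms Gen_terms)
qed

lemma term_eval_mono:
  assumes "lattice L" "g \<in> X \<rightarrow> carrier L" "term_le X s t"
  shows "term_eval L g s \<sqsubseteq>\<^bsub>L\<^esub> term_eval L g t"
proof -
  interpret lattice L by fact
  note closed = term_eval_closed[OF assms(1,2)]
  show ?thesis using assms(3)
  proof (induction rule: term_le.induct)
    case (trans s t u)
    then show ?case using term_le_terms[of X s t] term_le_terms[of X t u]
      by (blast intro: le_trans closed)
  next
    case (join_least s u t)
    then show ?case by (auto intro!: join_le closed dest: term_le_terms)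
  next
    case (meet_greatest u s t)
    then show ?case by (auto intro!: meet_le closed dest: term_le_terms)
  qed (auto intro: closed join_left join_right meet_left meet_right)
qed

theorem free_lattice_universal:
  assumes "lattice L" "g \<in> X \<rightarrow> carrier L"
  shows "\<exists>f \<in> lattice_hom (free_lattice X) L. \<forall>x\<in>X. f (free_class X (Gen x)) = g x"
    and "\<lbrakk>f \<in> lattice_hom (free_lattice X) L; f' \<in> lattice_hom (free_lattice X) L;
          \<And>x. x \<in> X \<Longrightarrow> f (free_class X (Gen x)) = f' (free_class X (Gen x));
          c \<in> carrier (free_lattice X)\<rbrakk> \<Longrightarrow> f c = f' c"
proof -
  interpret lattice L by fact
  define f where "f c = term_eval L g (SOME t. t \<in> c)" for c
  have f: "f (free_class X t) = term_eval L g t" if t: "t \<in> terms_over X" for t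
  proof -
    have "(SOME s. s \<in> free_class X t) \<in> free_class X t"
      by (rule someI[of _ t]) (simp add: free_class_mem term_le.refl t)
    then have "term_le X (SOME s. s \<in> free_class X t) t" "term_le X t (SOME s. s \<in> free_class X t)"
      by (auto simp: free_class_mem)
    then show ?thesis unfolding f_def
      by (meson le_antisym term_eval_mono[OF assms] term_eval_closed[OF assms] term_le_terms)
  qed
  have "f \<in> lattice_hom (free_lattice X) L"
    unfolding lattice_hom_def join_pres_def meet_pres_def
    by (auto simp: carrier_free_lattice f join_free_class meet_free_class Join_terms Meet_terms
        assms(1) lattice_free_lattice term_eval_closed[OF assms])
  then show "\<exists>f \<in> lattice_hom (free_lattice X) L. \<forall>x\<in>X. f (free_class X (Gen x)) = g x"
    by (rule bexI[rotated]) (simp add: f Gen_terms)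
next
  fix f f' c
  assume f: "f \<in> lattice_hom (free_lattice X) L" and f': "f' \<in> lattice_hom (free_lattice X) L"
    and gen: "\<And>x. x \<in> X \<Longrightarrow> f (free_class X (Gen x)) = f' (free_class X (Gen x))"
    and c: "c \<in> carrier (free_lattice X)"
  have "f (free_class X t) = f' (free_class X t)" if "t \<in> terms_over X" for t
    using that
  proof (induction t)
    case (Join s t)
    then show ?case using f f'
      by (simp add: lattice_hom_def join_pres_def carrier_free_lattice Join_terms
          flip: join_free_class)
  next
    case (Meet s t)
    then show ?case using f f'
      by (simp add: lattice_hom_def meet_pres_def carrier_free_lattice Meet_terms
          flip: meet_free_class)
  qed (simp add: gen Gen_terms)
  then show "f c = f' c" using c by (auto simp: carrier_free_lattice)
qed

section \<open>Bounded lattices in the sense of McKenzie\<close>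

text \<open>Not to be confused with \<^locale>\<open>bounded_lattice\<close>, which asks for a top and a bottom.
  Taking generators in \<^typ>\<open>nat\<close> loses nothing: up to isomorphism the free lattice depends only
  on the cardinality of the finite generating set.\<close>

definition lower_bounded_lattice :: "('a, 'c) gorder_scheme \<Rightarrow> bool"
  where "lower_bounded_lattice L \<longleftrightarrow>
    lattice L \<and> finite (carrier L) \<and>
    (\<exists>(X :: nat set) f. finite X \<and> f \<in> lattice_hom (free_lattice X) L \<and>
      f ` carrier (free_lattice X) = carrier L \<and>
      (\<forall>y \<in> carrier L.
        {x \<in> carrier (free_lattice X). y \<sqsubseteq>\<^bsub>L\<^esub> f x} = {} \<or>
        (\<exists>m. least (free_lattice X) m {x \<in> carrier (free_lattice X). y \<sqsubseteq>\<^bsub>L\<^esub> f x})))"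

definition upper_bounded_lattice :: "('a, 'c) gorder_scheme \<Rightarrow> bool"
  where "upper_bounded_lattice L \<longleftrightarrow> lower_bounded_lattice (inv_gorder L)"

definition McKenzie_bounded_lattice :: "('a, 'c) gorder_scheme \<Rightarrow> bool"
  where "McKenzie_bounded_lattice L \<longleftrightarrow> lower_bounded_lattice L \<and> upper_bounded_lattice L"

section \<open>The poset of covers\<close>

definition Cov :: "('a, 'c) gorder_scheme \<Rightarrow> ('a \<times> 'a) set"
  where "Cov P = {(a, b). a \<in> carrier P \<and> b \<in> carrier P \<and> a \<sqsubset>\<^bsub>P\<^esub> b \<and>
    \<not> (\<exists>c \<in> carrier P. a \<sqsubset>\<^bsub>P\<^esub> c \<and> c \<sqsubset>\<^bsub>P\<^esub> b)}"

definition Cov_le :: "('a, 'c) gorder_scheme \<Rightarrow> 'a \<times> 'a \<Rightarrow> 'a \<times> 'a \<Rightarrow> bool"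
  where "Cov_le L \<gamma> \<delta> \<longleftrightarrow>
    fst \<gamma> \<sqsubseteq>\<^bsub>L\<^esub> fst \<delta> \<and> \<not> snd \<gamma> \<sqsubseteq>\<^bsub>L\<^esub> fst \<delta> \<and> snd \<gamma> \<sqsubseteq>\<^bsub>L\<^esub> snd \<delta>"

definition Cov_poset :: "('a, 'c) gorder_scheme \<Rightarrow> ('a \<times> 'a) gorder"
  where "Cov_poset L = \<lparr> carrier = Cov L, eq = (=), le = Cov_le L \<rparr>"

definition comparability :: "('a, 'c) gorder_scheme \<Rightarrow> ('a \<times> 'a) set"
  where "comparability P =
    {(x, y). x \<in> carrier P \<and> y \<in> carrier P \<and> (x \<sqsubseteq>\<^bsub>P\<^esub> y \<or> y \<sqsubseteq>\<^bsub>P\<^esub> x)}"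

definition Cov_component :: "('a, 'c) gorder_scheme \<Rightarrow> 'a \<times> 'a \<Rightarrow> ('a \<times> 'a) gorder"
  where "Cov_component L \<gamma> =
    (Cov_poset L)\<lparr> carrier := {\<delta> \<in> Cov L. (\<gamma>, \<delta>) \<in> (comparability (Cov_poset L))\<^sup>*} \<rparr>"

lemma partial_order_Cov_poset:
  fixes L (structure)
  assumes "lattice L"
  shows "partial_order (Cov_poset L)"
proof -
  interpret lattice L by fact
  have trans: "Cov_le L (a, b) (e, f)"
    if cov: "(a, b) \<in> Cov L" "(c, d) \<in> Cov L" "(e, f) \<in> Cov L"
      and le: "Cov_le L (a, b) (c, d)" "Cov_le L (c, d) (e, f)" for a b c d e f
  proof -
    have car: "a \<in> carrier L" "b \<in> carrier L" "c \<in> carrier L" "d \<in> carrier L"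
      "e \<in> carrier L" "f \<in> carrier L"
      using cov by (auto simp: Cov_def)
    have les: "a \<sqsubseteq> c" "\<not> b \<sqsubseteq> c" "b \<sqsubseteq> d" "c \<sqsubseteq> e" "\<not> d \<sqsubseteq> e" "d \<sqsubseteq> f"
      using le by (auto simp: Cov_le_def)
    have "\<not> b \<sqsubseteq> e"
    proof
      assume "b \<sqsubseteq> e"
      have m: "d \<sqinter> e \<in> carrier L" using car by simp
      have "c \<sqsubseteq> d" using cov(2) by (auto simp: Cov_def lless_def)
      then have c: "c \<sqsubseteq> d \<sqinter> e" using les car by (intro meet_le) auto
      have b: "b \<sqsubseteq> d \<sqinter> e" using les \<open>b \<sqsubseteq> e\<close> car by (intro meet_le) auto
      have "d \<sqinter> e \<sqsubseteq> d" "d \<sqinter> e \<sqsubseteq> e" using car by (auto intro: meet_left meet_right)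
      then have "d \<sqinter> e \<sqsubset> d" using les by (auto simp: lless_def eq_is_equal)
      moreover have "c \<sqsubset> d \<sqinter> e" using c b les by (auto simp: lless_def eq_is_equal)
      ultimately show False using cov(2) m by (auto simp: Cov_def)
    qed
    then show ?thesis using les car by (auto simp: Cov_le_def intro: le_trans)
  qed
  have antisym: "(a, b) = (c, d)"
    if "(a, b) \<in> Cov L" "(c, d) \<in> Cov L" "Cov_le L (a, b) (c, d)" "Cov_le L (c, d) (a, b)"
    for a b c d
    using that by (auto simp: Cov_def Cov_le_def intro: le_antisym)
  have refl: "Cov_le L (a, b) (a, b)" if "(a, b) \<in> Cov L" for a b
    using that by (auto simp: Cov_def Cov_le_def lless_def eq_is_equal)
  show ?thesis
    by unfold_locales (auto simp: Cov_poset_def intro: refl trans dest: antisym)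
qed

end

theory Submission
  imports Defs
begin

text \<open>Write \<open>p D q\<close> for the join dependency relation. Whitman's condition for free lattices shows
  that a finite lattice is lower bounded iff \<open>D\<close> has no cycles on its join irreducible elements, and
  acyclicity of \<open>D\<close> forces join semidistributivity. So \<open>L\<close> is semidistributive, and then the
  component of a cover \<open>\<gamma>\<close> consists of the covers above \<open>(j0, j)\<close>, where \<open>j\<close> is least with
  \<open>j \<le> \<gamma>\<^sub>1\<close> and not \<open>j \<le> \<gamma>\<^sub>0\<close>, and \<open>j0\<close> is its lower cover. With \<open>m\<close> the dual choice, the order
  embedding \<open>\<delta> \<mapsto> \<delta>\<^sub>0\<close> of the component into the interval from \<open>j0\<close> to \<open>m\<close> has the left adjoint
  \<open>a \<mapsto> ((a \<squnion> j) \<sqinter> m, a \<squnion> j)\<close>. Hence the component is a lattice, and a join irreducible \<open>P\<close> of it is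
  the image of some join irreducible \<open>p\<close> of \<open>L\<close>. Since \<open>x \<le> m\<close> lies below the first entry of the
  image of \<open>a\<close> iff \<open>x \<le> a \<squnion> j\<close>, \<open>P D R\<close> implies \<open>p D r\<close>, so \<open>D\<close> is acyclic on the component. Upper
  boundedness follows by applying this to the dual of \<open>L\<close>.\<close>

section \<open>Whitman's condition\<close>

text \<open>The rules of \<open>term_le\<close> without transitivity as a rule. Transitivity is admissible by cut
  elimination, and Whitman's condition is then read off the last rule of a derivation.\<close>

inductive cut_free_le :: "'x lattice_term \<Rightarrow> 'x lattice_term \<Rightarrow> bool"
where
  gen: "cut_free_le (Gen x) (Gen x)"
| join_left: "\<lbrakk>cut_free_le s u; cut_free_le t u\<rbrakk> \<Longrightarrow> cut_free_le (Join s t) u"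
| join_right1: "cut_free_le u s \<Longrightarrow> cut_free_le u (Join s t)"
| join_right2: "cut_free_le u t \<Longrightarrow> cut_free_le u (Join s t)"
| meet_left1: "cut_free_le s u \<Longrightarrow> cut_free_le (Meet s t) u"
| meet_left2: "cut_free_le t u \<Longrightarrow> cut_free_le (Meet s t) u"
| meet_right: "\<lbrakk>cut_free_le u s; cut_free_le u t\<rbrakk> \<Longrightarrow> cut_free_le u (Meet s t)"

inductive_cases cut_free_le_Gen_Join: "cut_free_le (Gen x) (Join s t)"
inductive_cases cut_free_le_Meet_Join: "cut_free_le (Meet s t) (Join u v)"

lemma cut_free_le_refl: "cut_free_le t t"
  by (induction t) (auto intro: cut_free_le.intros)

text \<open>Invertibility of \<open>join_left\<close>: a right rule that comes last is reapplied to
  each half.\<close>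

lemma cut_free_le_Join_leftD:
  "cut_free_le (Join s t) u \<Longrightarrow> cut_free_le s u \<and> cut_free_le t u"
  by (induction "Join s t" u rule: cut_free_le.induct) (auto intro: cut_free_le.intros)

lemma cut_free_le_Meet_rightD:
  "cut_free_le u (Meet s t) \<Longrightarrow> cut_free_le u s \<and> cut_free_le u t"
  by (induction u "Meet s t" rule: cut_free_le.induct) (auto intro: cut_free_le.intros)

text \<open>Cut elimination, by induction on the cut term \<open>t\<close>. For a join the second
  derivation is inverted, and an inner induction on the first pushes the cut up to where
  \<open>t1\<close> or \<open>t2\<close> was introduced. Meets are dual, with the two derivations
  exchanged.\<close>

lemma cut_free_le_trans: "\<lbrakk>cut_free_le s t; cut_free_le t u\<rbrakk> \<Longrightarrow> cut_free_le s u"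
proof (induction t arbitrary: s u)
  case (Gen x)
  from Gen.prems show ?case
    by (induction s "Gen x :: 'a lattice_term" rule: cut_free_le.induct)
      (blast intro: cut_free_le.intros)+
next
  case (Join t1 t2)
  have u: "cut_free_le t1 u" "cut_free_le t2 u"
    using cut_free_le_Join_leftD[OF Join.prems(2)] by auto
  from Join.prems(1) show ?case
    by (induction s "Join t1 t2" rule: cut_free_le.induct)
      (blast intro: cut_free_le.intros Join.IH(1)[OF _ u(1)] Join.IH(2)[OF _ u(2)])+
next
  case (Meet t1 t2)
  have s: "cut_free_le s t1" "cut_free_le s t2"
    using cut_free_le_Meet_rightD[OF Meet.prems(1)] by auto
  from Meet.prems(2) show ?case
    by (induction "Meet t1 t2" u rule: cut_free_le.induct)
      (blast intro: cut_free_le.intros Meet.IH(1)[OF s(1)] Meet.IH(2)[OF s(2)])+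
qed

lemma term_le_imp_cut_free_le: "term_le X s t \<Longrightarrow> cut_free_le s t"
proof (induction rule: term_le.induct)
  case (trans s t u)
  then show ?case using cut_free_le_trans by blast
qed (simp_all add: cut_free_le_refl cut_free_le.intros)

lemma cut_free_le_imp_term_le:
  "\<lbrakk>cut_free_le s t; s \<in> terms_over X; t \<in> terms_over X\<rbrakk> \<Longrightarrow> term_le X s t"
proof (induction rule: cut_free_le.induct)
  case (join_right1 u s t)
  then show ?case by (meson Join_terms term_le.join_upper1 term_le.trans)
next
  case (join_right2 u t s)
  then show ?case by (meson Join_terms term_le.join_upper2 term_le.trans)
next
  case (meet_left1 s u t)
  then show ?case by (meson Meet_terms term_le.meet_lower1 term_le.trans)
next
  case (meet_left2 t u s)
  then show ?case by (meson Meet_terms term_le.meet_lower2 term_le.trans)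
qed (auto simp: Join_terms Meet_terms intro: term_le.intros)

lemma term_le_iff_cut_free_le:
  "term_le X s t \<longleftrightarrow> s \<in> terms_over X \<and> t \<in> terms_over X \<and> cut_free_le s t"
  using term_le_imp_cut_free_le cut_free_le_imp_term_le term_le_terms by blast

text \<open>Generators are join prime, because only the two right rules for joins can end such a
  derivation.\<close>

lemma Gen_le_Join:
  "term_le X (Gen x) (Join u v) \<Longrightarrow> term_le X (Gen x) u \<or> term_le X (Gen x) v"
  by (auto simp: term_le_iff_cut_free_le Join_terms elim: cut_free_le_Gen_Join)

text \<open>Whitman's condition: each disjunct comes from one of the four rules that can end a
  derivation with a meet on the left and a join on the right.\<close>

lemma Meet_le_Join:
  "term_le X (Meet s t) (Join u v) \<Longrightarrow>
    term_le X (Meet s t) u \<or> term_le X (Meet s t) v \<or>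
    term_le X s (Join u v) \<or> term_le X t (Join u v)"
  by (auto simp: term_le_iff_cut_free_le Join_terms Meet_terms elim: cut_free_le_Meet_Join)

section \<open>The arrow relations and join dependency\<close>

text \<open>One of the arrow relations of formal concept analysis: \<open>q\<close> is minimal
  outside the principal ideal of \<open>c\<close>. Quantifying over all \<open>r\<close> below
  \<open>q\<close> avoids naming the lower cover of \<open>q\<close>.\<close>

definition down_arrow :: "('a, 'c) gorder_scheme \<Rightarrow> 'a \<Rightarrow> 'a \<Rightarrow> bool"
  where "down_arrow L q c \<longleftrightarrow> q \<in> carrier L \<and> c \<in> carrier L \<and> \<not> q \<sqsubseteq>\<^bsub>L\<^esub> c \<and>
    (\<forall>r\<in>carrier L. r \<sqsubseteq>\<^bsub>L\<^esub> q \<longrightarrow> r \<noteq> q \<longrightarrow> r \<sqsubseteq>\<^bsub>L\<^esub> c)"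

definition up_arrow :: "('a, 'c) gorder_scheme \<Rightarrow> 'a \<Rightarrow> 'a \<Rightarrow> bool"
  where "up_arrow L p c \<longleftrightarrow> p \<in> carrier L \<and> c \<in> carrier L \<and> \<not> p \<sqsubseteq>\<^bsub>L\<^esub> c \<and>
    (\<forall>d\<in>carrier L. c \<sqsubseteq>\<^bsub>L\<^esub> d \<longrightarrow> d \<noteq> c \<longrightarrow> p \<sqsubseteq>\<^bsub>L\<^esub> d)"

text \<open>In a finite lattice \<open>p\<close> is join irreducible iff \<open>down_arrow L p e\<close> for some \<open>e\<close>, and the join
  dependency relation \<open>p D q\<close> says that \<open>up_arrow L p c\<close> and \<open>down_arrow L q c\<close> for some \<open>c\<close>. Hence
  a rank witnesses that \<open>D\<close> has no cycles.\<close>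

definition dependency_rank :: "('a, 'c) gorder_scheme \<Rightarrow> ('a \<Rightarrow> nat) \<Rightarrow> bool"
  where "dependency_rank L \<rho> \<longleftrightarrow> (\<forall>p q c e. down_arrow L p e \<longrightarrow> up_arrow L p c \<longrightarrow>
    down_arrow L q c \<longrightarrow> p \<noteq> q \<longrightarrow> \<rho> q < \<rho> p)"

definition dependency_ranked :: "('a, 'c) gorder_scheme \<Rightarrow> bool"
  where "dependency_ranked L \<longleftrightarrow> (\<exists>\<rho>. dependency_rank L \<rho>)"

lemma dependency_rankD:
  "\<lbrakk>dependency_rank L \<rho>; down_arrow L p e; up_arrow L p c; down_arrow L q c; p \<noteq> q\<rbrakk> \<Longrightarrow> \<rho> q < \<rho> p"
  unfolding dependency_rank_def by blast

text \<open>The source of join irreducibles throughout: a failing inequality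
  \<open>x \<sqsubseteq> c\<close> has a minimal witness, found by descending from \<open>x\<close>
  in the finite carrier.\<close>

lemma (in partial_order) ex_down_arrow:
  assumes "finite (carrier L)" "x \<in> carrier L" "c \<in> carrier L" "\<not> x \<sqsubseteq> c"
  shows "\<exists>q. q \<sqsubseteq> x \<and> down_arrow L q c"
  using assms(2,4)
proof (induction "card {y \<in> carrier L. y \<sqsubseteq> x}" arbitrary: x rule: less_induct)
  case less
  show ?case
  proof (cases "down_arrow L x c")
    case True
    then show ?thesis using less.prems by auto
  next
    case False
    then obtain r where r: "r \<in> carrier L" "r \<sqsubseteq> x" "r \<noteq> x" "\<not> r \<sqsubseteq> c"
      using less.prems assms(3) by (auto simp: down_arrow_def)
    have "{y \<in> carrier L. y \<sqsubseteq> r} \<subset> {y \<in> carrier L. y \<sqsubseteq> x}"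
      using r less.prems by (blast intro: le_trans dest: le_antisym)
    then have "card {y \<in> carrier L. y \<sqsubseteq> r} < card {y \<in> carrier L. y \<sqsubseteq> x}"
      using assms(1) by (simp add: psubset_card_mono)
    from less.hyps[OF this r(1,4)] obtain q where "q \<sqsubseteq> r" "down_arrow L q c" by blast
    moreover have "q \<in> carrier L" using \<open>down_arrow L q c\<close> by (simp add: down_arrow_def)
    ultimately show ?thesis using r less.prems by (blast intro: le_trans)
  qed
qed

lemma (in partial_order) ex_up_arrow:
  assumes "finite (carrier L)" "p \<in> carrier L" "d \<in> carrier L" "\<not> p \<sqsubseteq> d"
  shows "\<exists>c. d \<sqsubseteq> c \<and> up_arrow L p c"
  using partial_order.ex_down_arrow[OF dual_order, of d p] assms
  by (simp add: down_arrow_def up_arrow_def)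

lemma up_arrow_le_join:
  fixes L (structure)
  assumes "lattice L" "up_arrow L p c" "q \<in> carrier L" "\<not> q \<sqsubseteq> c"
  shows "p \<sqsubseteq> q \<squnion> c"
proof -
  interpret lattice L by fact
  have c: "c \<in> carrier L" using assms(2) by (simp add: up_arrow_def)
  have "c \<sqsubseteq> q \<squnion> c" using assms(3) c by (rule join_right)
  moreover have "q \<squnion> c \<noteq> c" using join_left[OF assms(3) c] assms(4) by auto
  moreover have "q \<squnion> c \<in> carrier L" using assms(3) c by simp
  ultimately show ?thesis using assms(2) by (simp add: up_arrow_def)
qed

section \<open>Join semidistributivity from acyclic join dependency\<close>

definition join_semidistributive :: "('a, 'c) gorder_scheme \<Rightarrow> bool"
  where "join_semidistributive L \<longleftrightarrow> (\<forall>a\<in>carrier L. \<forall>x\<in>carrier L. \<forall>y\<in>carrier L.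
    a \<squnion>\<^bsub>L\<^esub> x = a \<squnion>\<^bsub>L\<^esub> y \<longrightarrow> a \<squnion>\<^bsub>L\<^esub> (x \<sqinter>\<^bsub>L\<^esub> y) = a \<squnion>\<^bsub>L\<^esub> x)"

text \<open>Suppose \<open>d = a \<squnion> (x \<sqinter> y)\<close> is strictly below
  \<open>b = a \<squnion> x\<close>. A join irreducible \<open>p\<close> of least rank below
  \<open>b\<close> and not below \<open>d\<close> turns out to lie below both \<open>x\<close> and
  \<open>y\<close>, hence below \<open>d\<close>.\<close>

lemma dependency_ranked_imp_join_semidistributive:
  fixes L (structure)
  assumes "lattice L" "finite (carrier L)" "dependency_ranked L"
  shows "join_semidistributive L"
  unfolding join_semidistributive_def
proof (intro ballI impI)
  interpret lattice L by fact
  obtain \<rho> where \<rho>: "dependency_rank L \<rho>"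
    using assms(3) unfolding dependency_ranked_def by blast
  fix a x y
  assume axy: "a \<in> carrier L" "x \<in> carrier L" "y \<in> carrier L" "a \<squnion> x = a \<squnion> y"
  define b where "b = a \<squnion> x"
  define d where "d = a \<squnion> (x \<sqinter> y)"
  have bd: "b \<in> carrier L" "d \<in> carrier L" using axy by (simp_all add: b_def d_def)
  have ab: "a \<sqsubseteq> b" "x \<sqsubseteq> b" "y \<sqsubseteq> b" "a \<sqsubseteq> d" "x \<sqinter> y \<sqsubseteq> d"
    unfolding b_def d_def using axy by (metis join_left join_right meet_closed)+
  have "d \<sqsubseteq> b" unfolding d_def using axy ab bd
    by (intro join_le) (auto intro: le_trans[OF meet_left])
  moreover have "b \<sqsubseteq> d"
  proof (rule ccontr)
    assume "\<not> b \<sqsubseteq> d"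
    let ?Q = "\<lambda>p. p \<sqsubseteq> b \<and> \<not> p \<sqsubseteq> d \<and> (\<exists>e. down_arrow L p e)"
    have "\<exists>p. ?Q p" using ex_down_arrow[OF assms(2) bd \<open>\<not> b \<sqsubseteq> d\<close>]
      by (auto simp: down_arrow_def)
    then obtain p where p: "?Q p" and min: "\<And>q. ?Q q \<Longrightarrow> \<rho> p \<le> \<rho> q"
      using ex_has_least_nat[of ?Q _ \<rho>] by metis
    then have pc: "p \<in> carrier L" by (auto simp: down_arrow_def)
    then obtain c where c: "d \<sqsubseteq> c" "up_arrow L p c"
      using ex_up_arrow[OF assms(2) pc bd(2)] p by blast
    then have cc: "c \<in> carrier L" "\<not> p \<sqsubseteq> c" by (auto simp: up_arrow_def)
    have below: "p \<sqsubseteq> z" if z: "z \<in> carrier L" "a \<squnion> z = b" for z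
    proof -
      have "a \<sqsubseteq> c" using ab c cc axy bd by (blast intro: le_trans)
      have "z \<sqsubseteq> b" using z axy by (auto intro: join_right)
      have "\<not> z \<sqsubseteq> c"
      proof
        assume "z \<sqsubseteq> c"
        then have "b \<sqsubseteq> c" using z \<open>a \<sqsubseteq> c\<close> axy cc by (auto intro: join_le)
        then show False using p pc cc bd by (blast intro: le_trans)
      qed
      then obtain q where q: "q \<sqsubseteq> z" "down_arrow L q c"
        using ex_down_arrow[OF assms(2) z(1) cc(1)] by blast
      then have qc: "q \<in> carrier L" "\<not> q \<sqsubseteq> c" by (auto simp: down_arrow_def)
      then have "\<not> q \<sqsubseteq> d" using c cc bd by (blast intro: le_trans)
      moreover have "q \<sqsubseteq> b" using q z \<open>z \<sqsubseteq> b\<close> bd qc by (blast intro: le_trans)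
      \<comment> \<open>\<open>q\<close> competes with \<open>p\<close> in the choice of least rank,
        so \<open>p\<close> cannot depend on \<open>q\<close> unless they coincide.\<close>
      ultimately have "\<not> \<rho> q < \<rho> p" using min[of q] q by fastforce
      then have "p = q" using dependency_rankD[OF \<rho>] p c q by blast
      then show ?thesis using q by simp
    qed
    have "p \<sqsubseteq> x" "p \<sqsubseteq> y" using below axy b_def by auto
    then have "p \<sqsubseteq> x \<sqinter> y" using axy pc by (auto intro: meet_le)
    then show False using p ab axy pc bd by (meson le_trans meet_closed)
  qed
  ultimately show "a \<squnion> (x \<sqinter> y) = a \<squnion> x"
    using bd unfolding b_def d_def by (blast intro: le_antisym)
qed

section \<open>Lower bounded lattices and join dependency\<close>

lemma lattice_hom_free_class:
  assumes f: "f \<in> lattice_hom (free_lattice X) L" and t: "t \<in> terms_over X"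
  shows "f (free_class X t) = term_eval L (\<lambda>x. f (free_class X (Gen x))) t"
  using t
proof (induction t)
  case (Join s t)
  then show ?case using f
    by (simp add: lattice_hom_def join_pres_def carrier_free_lattice Join_terms
        flip: join_free_class)
next
  case (Meet s t)
  then show ?case using f
    by (simp add: lattice_hom_def meet_pres_def carrier_free_lattice Meet_terms
        flip: meet_free_class)
qed simp

text \<open>Trades classes and homomorphisms for terms and values of generators. Since the map is
  onto, no preimage set is empty, and the least preimage \<open>b\<close> has value exactly
  \<open>y\<close>: it lies below a term of value \<open>y\<close>.\<close>

lemma lower_bounded_lattice_iff:
  fixes L (structure)
  shows
  "lower_bounded_lattice L \<longleftrightarrow> lattice L \<and> finite (carrier L) \<and>
    (\<exists>(X :: nat set) g. finite X \<and> g \<in> X \<rightarrow> carrier L \<and>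
      (\<forall>y\<in>carrier L. \<exists>b\<in>terms_over X. term_eval L g b = y \<and>
        (\<forall>t\<in>terms_over X. y \<sqsubseteq>\<^bsub>L\<^esub> term_eval L g t \<longrightarrow> term_le X b t)))"
    (is "_ \<longleftrightarrow> _ \<and> _ \<and> (\<exists>X g. ?P X g)")
proof (rule iffI; (elim conjE exE)?)
  assume "lower_bounded_lattice L"
  then obtain X :: "nat set" and f where L: "lattice L" "finite (carrier L)" and X: "finite X"
    and f: "f \<in> lattice_hom (free_lattice X) L"
    and surj: "f ` carrier (free_lattice X) = carrier L"
    and bd: "\<forall>y\<in>carrier L. {x \<in> carrier (free_lattice X). y \<sqsubseteq>\<^bsub>L\<^esub> f x} = {} \<or>
        (\<exists>m. least (free_lattice X) m {x \<in> carrier (free_lattice X). y \<sqsubseteq>\<^bsub>L\<^esub> f x})"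
    unfolding lower_bounded_lattice_def by (elim conjE exE) (rule that)
  interpret lattice L by fact
  define g where "g x = f (free_class X (Gen x))" for x
  have g: "g \<in> X \<rightarrow> carrier L"
    using f by (auto simp: g_def lattice_hom_def carrier_free_lattice Gen_terms)
  have ev: "f (free_class X t) = term_eval L g t" if "t \<in> terms_over X" for t
    using lattice_hom_free_class[OF f that] by (simp add: g_def[abs_def])
  have "\<exists>b\<in>terms_over X. term_eval L g b = y \<and>
        (\<forall>t\<in>terms_over X. y \<sqsubseteq>\<^bsub>L\<^esub> term_eval L g t \<longrightarrow> term_le X b t)" if y: "y \<in> carrier L" for y
  proof -
    obtain s where s: "s \<in> terms_over X" "f (free_class X s) = y"
      using surj y unfolding carrier_free_lattice by (metis imageE)
    then have "free_class X s \<in> {x \<in> carrier (free_lattice X). y \<sqsubseteq>\<^bsub>L\<^esub> f x}"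
      using y by (simp add: carrier_free_lattice)
    then obtain m where "least (free_lattice X) m {x \<in> carrier (free_lattice X). y \<sqsubseteq>\<^bsub>L\<^esub> f x}"
      using bd y by blast
    then have m: "m \<in> carrier (free_lattice X)" "y \<sqsubseteq> f m"
      "\<And>x. \<lbrakk>x \<in> carrier (free_lattice X); y \<sqsubseteq> f x\<rbrakk> \<Longrightarrow> m \<sqsubseteq>\<^bsub>free_lattice X\<^esub> x"
      by (auto simp: least_def)
    then obtain b where b: "b \<in> terms_over X" "m = free_class X b"
      by (auto simp: carrier_free_lattice)
    have least: "term_le X b t" if "t \<in> terms_over X" "y \<sqsubseteq> term_eval L g t" for t
      using m(3)[of "free_class X t"] that b by (simp add: carrier_free_lattice ev le_free_class)
    have "term_eval L g b \<sqsubseteq> y"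
      using term_eval_mono[OF L(1) g least[OF s(1)]] ev[OF s(1)] s y by simp
    then have "term_eval L g b = y"
      using m(2) b y term_eval_closed[OF L(1) g b(1)] by (auto simp: ev intro: le_antisym)
    then show ?thesis using b least by blast
  qed
  then show "lattice L \<and> finite (carrier L) \<and> (\<exists>X g. ?P X g)"
    using L X g by (intro conjI exI[of _ X] exI[of _ g] ballI)
next
  fix X :: "nat set" and g
  assume L: "lattice L" "finite (carrier L)" and X: "finite X" and g: "g \<in> X \<rightarrow> carrier L"
    and bd: "\<forall>y\<in>carrier L. \<exists>b\<in>terms_over X. term_eval L g b = y \<and>
        (\<forall>t\<in>terms_over X. y \<sqsubseteq>\<^bsub>L\<^esub> term_eval L g t \<longrightarrow> term_le X b t)"
  interpret lattice L by fact
  obtain f where f: "f \<in> lattice_hom (free_lattice X) L"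
    and fg: "\<And>x. x \<in> X \<Longrightarrow> f (free_class X (Gen x)) = g x"
    using free_lattice_universal(1)[OF L(1) g] by blast
  have ev: "f (free_class X t) = term_eval L g t" if "t \<in> terms_over X" for t
  proof -
    have "term_eval L (\<lambda>x. f (free_class X (Gen x))) t = term_eval L g t"
      using that by (induction t) (simp_all add: fg Gen_terms Join_terms Meet_terms)
    then show ?thesis using lattice_hom_free_class[OF f that] by simp
  qed
  have surj: "f ` carrier (free_lattice X) = carrier L"
  proof
    show "f ` carrier (free_lattice X) \<subseteq> carrier L" using f by (auto simp: lattice_hom_def)
    show "carrier L \<subseteq> f ` carrier (free_lattice X)"
    proof
      fix y assume "y \<in> carrier L"
      then obtain b where "b \<in> terms_over X" "term_eval L g b = y" using bd by blast
      then show "y \<in> f ` carrier (free_lattice X)"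
        using ev by (auto simp: carrier_free_lattice image_iff intro!: bexI[of _ b])
    qed
  qed
  have "\<exists>m. least (free_lattice X) m {x \<in> carrier (free_lattice X). y \<sqsubseteq> f x}"
    if y: "y \<in> carrier L" for y
  proof -
    obtain b where b: "b \<in> terms_over X" "term_eval L g b = y"
        "\<And>t. \<lbrakk>t \<in> terms_over X; y \<sqsubseteq> term_eval L g t\<rbrakk> \<Longrightarrow> term_le X b t"
      using bd y by blast
    have "least (free_lattice X) (free_class X b) {x \<in> carrier (free_lattice X). y \<sqsubseteq> f x}"
      using b y by (auto simp: least_def carrier_free_lattice ev le_free_class)
    then show ?thesis by blast
  qed
  then show "lower_bounded_lattice L"
    unfolding lower_bounded_lattice_def using L X f surj
    by (intro conjI exI[of _ X] exI[of _ f] ballI disjI2)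
qed

text \<open>By Whitman's condition a term for the least preimage of \<open>p\<close> contains a term for the least
  preimage of each \<open>q\<close> on which \<open>p\<close> depends, so the least size of such a term is a rank.\<close>

lemma lower_bounded_imp_dependency_ranked:
  fixes L (structure)
  assumes "lower_bounded_lattice L"
  shows "dependency_ranked L"
proof -
  obtain X :: "nat set" and g where L: "lattice L" and g: "g \<in> X \<rightarrow> carrier L"
    and bd: "\<forall>y\<in>carrier L. \<exists>b\<in>terms_over X. term_eval L g b = y \<and>
        (\<forall>t\<in>terms_over X. y \<sqsubseteq>\<^bsub>L\<^esub> term_eval L g t \<longrightarrow> term_le X b t)"
    using assms unfolding lower_bounded_lattice_iff by (elim conjE exE) (rule that)
  interpret lattice L by fact
  define ev where "ev = term_eval L g"
  obtain b where b: "\<And>y. y \<in> carrier L \<Longrightarrow> b y \<in> terms_over X \<and> ev (b y) = y"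
    and least: "\<And>y t. \<lbrakk>y \<in> carrier L; t \<in> terms_over X; y \<sqsubseteq> ev t\<rbrakk> \<Longrightarrow> term_le X (b y) t"
    using bd unfolding ev_def by metis
  have ev_closed: "ev t \<in> carrier L" if "t \<in> terms_over X" for t
    unfolding ev_def by (rule term_eval_closed[OF L g that])
  have ev_mono: "ev s \<sqsubseteq> ev t" if "term_le X s t" for s t
    unfolding ev_def by (rule term_eval_mono[OF L g that])
  define represents where "represents t y \<longleftrightarrow> term_le X t (b y) \<and> term_le X (b y) t" for t y
  define \<rho> where "\<rho> y = (LEAST n. \<exists>t. represents t y \<and> size t = n)" for y
  have \<rho>_le: "\<rho> y \<le> size t" if "represents t y" for t y
    unfolding \<rho>_def using that by (intro Least_le) blast
  have \<rho>_eq: "\<exists>t. represents t y \<and> size t = \<rho> y" if "y \<in> carrier L" for y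
    unfolding \<rho>_def by (rule LeastI_ex)
      (use b[OF that] in \<open>auto simp: represents_def intro: term_le.refl\<close>)
  \<comment> \<open>As \<open>b q\<close> has value \<open>q\<close>, the value of \<open>t\<close>
    is below \<open>q\<close>. Minimality of \<open>q\<close> outside the ideal of \<open>c\<close>
    forces \<open>ev t = q\<close>, and leastness of \<open>b q\<close> then gives the converse
    inequality.\<close>
  have leaf: "represents t q"
    if q: "down_arrow L q c" and t: "\<not> ev t \<sqsubseteq> c" "term_le X t (b q)" for t q c
  proof -
    have qc: "q \<in> carrier L" using q by (simp add: down_arrow_def)
    have "ev t \<sqsubseteq> q" using ev_mono[OF t(2)] b[OF qc] by simp
    moreover have tX: "t \<in> terms_over X" using t(2) term_le_terms by blast
    ultimately have "ev t = q" using q t ev_closed by (auto simp: down_arrow_def)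
    then show ?thesis using least[OF qc tX] qc t by (simp add: represents_def)
  qed
  \<comment> \<open>Descent through subterms of \<open>t\<close> whose value is not below
    \<open>c\<close>, until primality of generators or Whitman's condition puts one of them below
    \<open>b q\<close>. The last clause yields a strict decrease in size once \<open>t' = t\<close>
    is excluded.\<close>
  have key: "\<exists>t'. represents t' q \<and> size t' \<le> size t \<and> (size t' = size t \<longrightarrow> t' = t)"
    if q: "down_arrow L q c" and t: "\<not> ev t \<sqsubseteq> c" "term_le X t (Join (b q) (b c))" for t q c
  proof -
    have car: "q \<in> carrier L" "c \<in> carrier L" using q by (auto simp: down_arrow_def)
    have not_c: "\<not> term_le X t (b c)" if "\<not> ev t \<sqsubseteq> c" for t
      using ev_mono[of t "b c"] b[OF car(2)] that by auto
    show ?thesis using t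
    proof (induction t)
      case (Gen x)
      then have "term_le X (Gen x) (b q)"
        using Gen_le_Join[OF Gen.prems(2)] not_c[OF Gen.prems(1)] by blast
      then show ?case using leaf[OF q Gen.prems(1)] by blast
    next
      case (Join s t)
      have st: "s \<in> terms_over X" "t \<in> terms_over X"
        using Join.prems(2) term_le_terms[of X "Join s t"] by (auto simp: Join_terms)
      then have le: "term_le X s (Join (b q) (b c))" "term_le X t (Join (b q) (b c))"
        using term_le.trans[OF term_le.join_upper1[OF st] Join.prems(2)]
          term_le.trans[OF term_le.join_upper2[OF st] Join.prems(2)] by simp_all
      have "\<not> ev s \<sqsubseteq> c \<or> \<not> ev t \<sqsubseteq> c"
        using Join.prems(1) ev_closed[OF st(1)] ev_closed[OF st(2)] car
        by (auto simp: ev_def intro: join_le)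
      then obtain t' where "represents t' q" "size t' < size (Join s t)"
        using Join.IH(1)[OF _ le(1)] Join.IH(2)[OF _ le(2)] by fastforce
      then show ?case by (intro exI[of _ t']) simp
    next
      case (Meet s t)
      have st: "s \<in> terms_over X" "t \<in> terms_over X"
        using Meet.prems(2) term_le_terms[of X "Meet s t"] by (auto simp: Meet_terms)
      have "ev (Meet s t) \<in> carrier L" using st by (simp add: ev_closed Meet_terms)
      then have ev: "\<not> ev s \<sqsubseteq> c" "\<not> ev t \<sqsubseteq> c"
        using Meet.prems(1) le_trans[OF ev_mono[OF term_le.meet_lower1[OF st]]]
          le_trans[OF ev_mono[OF term_le.meet_lower2[OF st]]]
          ev_closed[OF st(1)] ev_closed[OF st(2)] car by metis+
      from Meet_le_Join[OF Meet.prems(2)] not_c[OF Meet.prems(1)]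
      consider "term_le X (Meet s t) (b q)" | "term_le X s (Join (b q) (b c))"
        | "term_le X t (Join (b q) (b c))" by blast
      then show ?case
      proof cases
        case 1
        then show ?thesis using leaf[OF q Meet.prems(1)] by blast
      next
        case 2
        then obtain t' where "represents t' q" "size t' < size (Meet s t)"
          using Meet.IH(1)[OF ev(1)] by fastforce
        then show ?thesis by (intro exI[of _ t']) simp
      next
        case 3
        then obtain t' where "represents t' q" "size t' < size (Meet s t)"
          using Meet.IH(2)[OF ev(2)] by fastforce
        then show ?thesis by (intro exI[of _ t']) simp
      qed
    qed
  qed
  have "\<rho> q < \<rho> p" if pq: "up_arrow L p c" "down_arrow L q c" "p \<noteq> q" for p q c
  proof -
    have car: "p \<in> carrier L" "q \<in> carrier L" "c \<in> carrier L" "\<not> p \<sqsubseteq> c" "\<not> q \<sqsubseteq> c"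
      using pq by (auto simp: up_arrow_def down_arrow_def)
    obtain t where t: "represents t p" "size t = \<rho> p" using \<rho>_eq car by blast
    then have tX: "t \<in> terms_over X" and tb: "term_le X t (b p)" "term_le X (b p) t"
      using term_le_terms by (auto simp: represents_def)
    have evt: "ev t = p"
      using ev_mono[OF tb(1)] ev_mono[OF tb(2)] b[OF car(1)] ev_closed[OF tX] car
      by (auto intro: le_antisym)
    \<comment> \<open>As \<open>b p\<close> is least among the terms with value above
      \<open>p\<close>, this inequality in \<open>L\<close> lifts to one between terms.\<close>
    have "p \<sqsubseteq> q \<squnion> c" by (rule up_arrow_le_join[OF L pq(1) car(2,5)])
    moreover have "ev (Join (b q) (b c)) = q \<squnion> c" using b car by (simp add: ev_def)
    ultimately have "term_le X (b p) (Join (b q) (b c))"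
      using least car b by (simp add: Join_terms)
    then have "term_le X t (Join (b q) (b c))" using tb by (blast intro: term_le.trans)
    then obtain t' where t': "represents t' q" "size t' \<le> size t" "size t' = size t \<longrightarrow> t' = t"
      using key[OF pq(2)] evt car by blast
    have "t' \<noteq> t"
    proof
      assume "t' = t"
      then have "ev t = q" using t'(1) ev_mono b[OF car(2)] ev_closed[OF tX] car
        by (metis le_antisym represents_def)
      then show False using evt pq by simp
    qed
    then show ?thesis using t' t \<rho>_le[OF t'(1)] by linarith
  qed
  then have "dependency_rank L \<rho>" by (simp add: dependency_rank_def)
  then show ?thesis unfolding dependency_ranked_def by blast
qed

section \<open>From a rank back to least preimages\<close>

text \<open>Terms have no constants for top and bottom, so only nonempty sets are given a meet term.
  The universal property is stated for values in \<open>L\<close>, the form that places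
  \<open>p\<close> below the meet.\<close>

lemma ex_meet_term:
  assumes L: "lattice L" and g: "g \<in> X \<rightarrow> carrier L"
    and T: "finite T" "T \<noteq> {}" "T \<subseteq> terms_over X"
  shows "\<exists>m\<in>terms_over X. (\<forall>t\<in>T. term_le X m t) \<and>
    (\<forall>z\<in>carrier L. (\<forall>t\<in>T. z \<sqsubseteq>\<^bsub>L\<^esub> term_eval L g t) \<longrightarrow> z \<sqsubseteq>\<^bsub>L\<^esub> term_eval L g m)"
  using T
proof (induction rule: finite_ne_induct)
  case (singleton t)
  then show ?case by (intro bexI[of _ t]) (simp_all add: term_le.refl)
next
  case (insert t T)
  interpret lattice L by fact
  have "T \<subseteq> terms_over X" using insert.prems by simp
  from insert.IH[OF this] obtain m where m: "m \<in> terms_over X" "\<And>t. t \<in> T \<Longrightarrow> term_le X m t"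
      "\<And>z. \<lbrakk>z \<in> carrier L; \<forall>t\<in>T. z \<sqsubseteq>\<^bsub>L\<^esub> term_eval L g t\<rbrakk> \<Longrightarrow> z \<sqsubseteq>\<^bsub>L\<^esub> term_eval L g m"
    by metis
  have t: "t \<in> terms_over X" using insert.prems by simp
  have "term_le X (Meet t m) t" "term_le X (Meet t m) m"
    using t m(1) by (rule term_le.meet_lower1 term_le.meet_lower2)+
  then show ?case using t m(1,3) term_eval_closed[OF L g] term_le.trans[OF _ m(2)]
    by (intro bexI[of _ "Meet t m"]) (simp_all add: Meet_terms meet_le)
qed

lemma ex_join_term:
  assumes T: "finite T" "T \<noteq> {}" "T \<subseteq> terms_over X"
  shows "\<exists>j\<in>terms_over X. (\<forall>t\<in>T. term_le X t j) \<and>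
    (\<forall>u. (\<forall>t\<in>T. term_le X t u) \<longrightarrow> term_le X j u)"
  using T
proof (induction rule: finite_ne_induct)
  case (singleton t)
  then show ?case by (intro bexI[of _ t]) (simp_all add: term_le.refl)
next
  case (insert t T)
  then obtain j where j: "j \<in> terms_over X" "\<And>t. t \<in> T \<Longrightarrow> term_le X t j"
      "\<And>u. (\<And>t. t \<in> T \<Longrightarrow> term_le X t u) \<Longrightarrow> term_le X j u"
    by (metis insert_subset)
  have t: "t \<in> terms_over X" using insert.prems by simp
  have "term_le X t (Join t j)" "term_le X j (Join t j)"
    using t j(1) by (rule term_le.join_upper1 term_le.join_upper2)+
  then show ?case using t j(1,3) term_le.trans[OF j(2)]
    by (intro bexI[of _ "Join t j"]) (simp_all add: Join_terms term_le.join_least)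
qed

text \<open>A nontrivial join cover of \<open>p\<close> refines to join irreducibles of smaller
  rank. If \<open>p\<close> were not below \<open>d\<close>, take \<open>c\<close> above
  \<open>d\<close> maximal among elements not above \<open>p\<close>. If \<open>a\<close> or
  \<open>b\<close> were not below \<open>c\<close>, a minimal witness \<open>q\<close> would be one
  on which \<open>p\<close> depends, hence below \<open>d\<close> and \<open>c\<close>. So
  \<open>a\<close> and \<open>b\<close> are below \<open>c\<close>, and with them
  \<open>p\<close>.\<close>

lemma dependency_ranked_refine_join:
  fixes L (structure)
  assumes L: "lattice L" "finite (carrier L)"
    and \<rho>: "dependency_rank L \<rho>"
    and p: "down_arrow L p e" and ab: "a \<in> carrier L" "b \<in> carrier L"
    and le: "p \<sqsubseteq> a \<squnion> b" "\<not> p \<sqsubseteq> a" "\<not> p \<sqsubseteq> b"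
    and d: "d \<in> carrier L" "\<And>q e. \<lbrakk>down_arrow L q e; \<rho> q < \<rho> p; q \<sqsubseteq> a \<or> q \<sqsubseteq> b\<rbrakk> \<Longrightarrow> q \<sqsubseteq> d"
  shows "p \<sqsubseteq> d"
proof (rule ccontr)
  interpret lattice L by fact
  assume "\<not> p \<sqsubseteq> d"
  moreover have pc: "p \<in> carrier L" using p by (simp add: down_arrow_def)
  ultimately obtain c where c: "d \<sqsubseteq> c" "up_arrow L p c"
    using ex_up_arrow[OF L(2) _ d(1)] by blast
  then have cc: "c \<in> carrier L" "\<not> p \<sqsubseteq> c" by (auto simp: up_arrow_def)
  have "z \<sqsubseteq> c" if z: "z \<in> carrier L" "z = a \<or> z = b" for z
  proof (rule ccontr)
    assume "\<not> z \<sqsubseteq> c"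
    then obtain q where q: "q \<sqsubseteq> z" "down_arrow L q c"
      using ex_down_arrow[OF L(2) z(1) cc(1)] by blast
    then have "p \<noteq> q" using z le by auto
    then have "q \<sqsubseteq> d" using d(2)[OF q(2) dependency_rankD[OF \<rho> p c(2) q(2)]] q(1) z(2) by blast
    then show False using q c cc d(1) le_trans[of q d c] by (simp add: down_arrow_def)
  qed
  then have "a \<squnion> b \<sqsubseteq> c" using ab cc by (simp add: join_le)
  then show False using le_trans[OF le(1)] cc pc ab by simp
qed

text \<open>The least preimages \<open>b p\<close> of the join irreducible elements are constructed by recursion on the
  rank: \<open>b p\<close> is the meet of the generators above \<open>p\<close> and of the joins of \<open>b q\<close> over all
  sets of \<open>q\<close> of smaller rank whose join is above \<open>p\<close>.\<close>

lemma dependency_ranked_imp_lower_bounded: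
  fixes L (structure)
  assumes L: "lattice L" "finite (carrier L)" "carrier L \<noteq> {}" and "dependency_ranked L"
  shows "lower_bounded_lattice L"
proof -
  interpret lattice L by fact
  obtain \<rho> where \<rho>: "dependency_rank L \<rho>"
    using assms(4) unfolding dependency_ranked_def by blast
  \<comment> \<open>One generator for each element of \<open>L\<close>. Thus some generator has
    value \<open>p\<close>, and later a generator of value \<open>y\<close> bounds the value of the
    least preimage.\<close>
  obtain g :: "nat \<Rightarrow> _" where bij: "bij_betw g {..<card (carrier L)} (carrier L)"
    using ex_bij_betw_nat_finite[OF L(2)] by (metis atLeast0LessThan)
  define X where "X = {..<card (carrier L)}"
  have X: "finite X" by (simp add: X_def)
  have gX: "g ` X = carrier L" using bij by (simp add: X_def bij_betw_def)
  then have g: "g \<in> X \<rightarrow> carrier L" by auto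
  have Xne: "X \<noteq> {}" using gX L(3) by auto
  define ev where "ev = term_eval L g"
  have ev_closed: "ev t \<in> carrier L" if "t \<in> terms_over X" for t
    unfolding ev_def by (rule term_eval_closed[OF L(1) g that])
  have ev_mono: "ev s \<sqsubseteq> ev t" if "term_le X s t" for s t
    unfolding ev_def by (rule term_eval_mono[OF L(1) g that])
  have ev_trans: "z \<sqsubseteq> ev t" if "z \<in> carrier L" "z \<sqsubseteq> ev s" "term_le X s t" for z s t
    using le_trans[OF that(2) ev_mono[OF that(3)]] that ev_closed term_le_terms[OF that(3)]
    by simp
  \<comment> \<open>Only \<open>y \<sqsubseteq> ev b\<close> is asked for here; equality follows at
    the end by comparing \<open>b\<close> with a generator of value \<open>y\<close>.\<close>
  define is_least where "is_least y b \<longleftrightarrow> b \<in> terms_over X \<and> y \<sqsubseteq> ev b \<and>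
    (\<forall>t\<in>terms_over X. y \<sqsubseteq> ev t \<longrightarrow> term_le X b t)" for y b
  have irreducible: "\<exists>b. is_least p b" if "down_arrow L p e" for p e
    using that
  proof (induction "\<rho> p" arbitrary: p e rule: less_induct)
    case less
    have pc: "p \<in> carrier L" using less.prems by (simp add: down_arrow_def)
    define R where "R = {q \<in> carrier L. (\<exists>e. down_arrow L q e) \<and> \<rho> q < \<rho> p}"
    have "\<exists>b. is_least q b" if "q \<in> R" for q
      using that less.hyps by (auto simp: R_def)
    then obtain b where b: "\<And>q. q \<in> R \<Longrightarrow> is_least q (b q)" by metis
    have bX: "b ` S \<subseteq> terms_over X" if "S \<subseteq> R" for S
      using b that by (auto simp: is_least_def)
    define joins where "joins S = (SOME j. j \<in> terms_over X \<and> (\<forall>t\<in>b ` S. term_le X t j) \<and>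
      (\<forall>u. (\<forall>t\<in>b ` S. term_le X t u) \<longrightarrow> term_le X j u))" for S
    have finR: "finite S" if "S \<subseteq> R" for S
      by (rule finite_subset[OF that]) (simp add: R_def L(2))
    have joins: "joins S \<in> terms_over X \<and> (\<forall>t\<in>b ` S. term_le X t (joins S)) \<and>
        (\<forall>u. (\<forall>t\<in>b ` S. term_le X t u) \<longrightarrow> term_le X (joins S) u)"
      if "S \<subseteq> R" "S \<noteq> {}" for S
      unfolding joins_def
      by (rule someI_ex) (use ex_join_term[of "b ` S" X] bX[OF that(1)] finR that in blast)
    define \<S> where "\<S> = {S. S \<subseteq> R \<and> S \<noteq> {} \<and> p \<sqsubseteq> ev (joins S)}"
    define T where "T = Gen ` {x \<in> X. p \<sqsubseteq> g x} \<union> joins ` \<S>"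
    have "finite \<S>" unfolding \<S>_def by (rule finite_subset[of _ "Pow R"]) (auto simp: finR)
    then have T1: "finite T" using X by (simp add: T_def)
    have "p \<in> g ` X" using gX pc by simp
    then have T2: "T \<noteq> {}" using pc by (auto simp: T_def)
    have T3: "T \<subseteq> terms_over X" using joins by (auto simp: T_def \<S>_def Gen_terms)
    obtain m where m: "m \<in> terms_over X" "\<forall>t\<in>T. term_le X m t"
        "\<forall>z\<in>carrier L. (\<forall>t\<in>T. z \<sqsubseteq> ev t) \<longrightarrow> z \<sqsubseteq> ev m"
      using ex_meet_term[OF L(1) g T1 T2 T3] unfolding ev_def by blast
    have "\<forall>t\<in>T. p \<sqsubseteq> ev t" by (auto simp: T_def \<S>_def ev_def)
    then have "p \<sqsubseteq> ev m" using m pc by blast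
    moreover have "term_le X m t" if "t \<in> terms_over X" "p \<sqsubseteq> ev t" for t
      using that
    proof (induction t)
      case (Gen x)
      then have "Gen x \<in> T" by (auto simp: T_def Gen_terms ev_def)
      then show ?case using m by blast
    next
      case (Meet s t)
      then have st: "s \<in> terms_over X" "t \<in> terms_over X" by (simp_all add: Meet_terms)
      have "p \<sqsubseteq> ev s" "p \<sqsubseteq> ev t"
        using ev_trans[OF pc Meet.prems(2)] term_le.meet_lower1[OF st] term_le.meet_lower2[OF st]
        by simp_all
      then show ?case using Meet.IH st by (simp add: term_le.meet_greatest)
    next
      case (Join s t)
      then have st: "s \<in> terms_over X" "t \<in> terms_over X" by (simp_all add: Join_terms)
      note up = term_le.join_upper1[OF st] term_le.join_upper2[OF st]
      consider "p \<sqsubseteq> ev s" | "p \<sqsubseteq> ev t" | "\<not> p \<sqsubseteq> ev s" "\<not> p \<sqsubseteq> ev t" by blast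
      then show ?case
      proof cases
        case 1
        then show ?thesis using Join.IH(1) st up(1) term_le.trans by blast
      next
        case 2
        then show ?thesis using Join.IH(2) st up(2) term_le.trans by blast
      next
        case 3
        \<comment> \<open>The join irreducibles of smaller rank below either summand. Their join
          refines the cover of \<open>p\<close> by \<open>s\<close> and \<open>t\<close>, so it is
          one of the terms whose meet is \<open>m\<close>.\<close>
        define S where "S = {q \<in> R. q \<sqsubseteq> ev s \<or> q \<sqsubseteq> ev t}"
        have S: "S \<subseteq> R" by (auto simp: S_def)
        have evst: "ev s \<in> carrier L" "ev t \<in> carrier L" using st by (simp_all add: ev_closed)
        have pst: "p \<sqsubseteq> ev s \<squnion> ev t" using Join.prems by (simp add: ev_def)
        note refine = dependency_ranked_refine_join[of L \<rho>, OF L(1,2) \<rho> less.prems evst pst 3]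
        have inS: "q \<in> S" if "down_arrow L q e" "\<rho> q < \<rho> p" "q \<sqsubseteq> ev s \<or> q \<sqsubseteq> ev t" for q e
          using that by (auto simp: S_def R_def down_arrow_def)
        \<comment> \<open>With no such \<open>q\<close>, the bound asked for in the refinement lemma
          holds vacuously for \<open>ev s\<close>.\<close>
        have "S \<noteq> {}"
        proof
          assume "S = {}"
          then have "p \<sqsubseteq> ev s" using inS by (intro refine) (auto simp: evst)
          then show False using 3 by simp
        qed
        note j = joins[OF S this]
        then have jX: "joins S \<in> terms_over X" by blast
        have "p \<sqsubseteq> ev (joins S)"
        proof (rule refine)
          fix q e
          assume "down_arrow L q e" "\<rho> q < \<rho> p" "q \<sqsubseteq> ev s \<or> q \<sqsubseteq> ev t"
          then have q: "q \<in> S" by (rule inS)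
          have "is_least q (b q)" using b S q by blast
          then have "q \<in> carrier L" "q \<sqsubseteq> ev (b q)" "term_le X (b q) (joins S)"
            using j q by (auto simp: is_least_def S_def R_def)
          then show "q \<sqsubseteq> ev (joins S)"
            by (rule ev_trans)
        qed (rule ev_closed[OF jX])
        then have "joins S \<in> T" using S \<open>S \<noteq> {}\<close> by (auto simp: T_def \<S>_def)
        moreover have "term_le X (joins S) (Join s t)"
        proof -
          have "term_le X (b q) (Join s t)" if "q \<in> S" for q
          proof -
            have "is_least q (b q)" using b S that by blast
            then have "term_le X (b q) s \<or> term_le X (b q) t"
              using that st by (auto simp: S_def is_least_def)
            then show ?thesis using up term_le.trans by blast
          qed
          then show ?thesis using j by blast
        qed
        ultimately show ?thesis using m term_le.trans by blast
      qed
    qed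
    ultimately have "is_least p m" using m by (simp add: is_least_def)
    then show ?case by blast
  qed
  have "\<exists>b. is_least y b" if y: "y \<in> carrier L" for y
  proof -
    define P where "P = {p \<in> carrier L. (\<exists>e. down_arrow L p e) \<and> p \<sqsubseteq> y}"
    have "\<exists>b. is_least p b" if "p \<in> P" for p
      using that irreducible by (auto simp: P_def)
    then obtain b where b: "\<And>p. p \<in> P \<Longrightarrow> is_least p (b p)" by metis
    have GenX: "Gen ` X \<subseteq> terms_over X" by (auto simp: Gen_terms)
    \<comment> \<open>A least term, as the meet of all generators. It keeps the set to be joined
      nonempty when \<open>y\<close> is the bottom of \<open>L\<close> and \<open>P\<close> is
      empty.\<close>
    obtain z where z: "z \<in> terms_over X" "\<forall>t\<in>Gen ` X. term_le X z t"
      using ex_meet_term[OF L(1) g _ _ GenX] X Xne by blast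
    have bottom: "term_le X z t" if "t \<in> terms_over X" for t
      using that
    proof (induction t)
      case (Join s t)
      then show ?case using term_le.join_upper1 term_le.trans by (metis Join_terms)
    qed (use z in \<open>auto simp: Gen_terms Meet_terms intro: term_le.meet_greatest\<close>)
    have "finite (insert z (b ` P))" using L(2) by (simp add: P_def)
    moreover have "insert z (b ` P) \<subseteq> terms_over X" using b z by (auto simp: is_least_def)
    ultimately obtain j where j: "j \<in> terms_over X" "\<forall>t\<in>insert z (b ` P). term_le X t j"
        "\<forall>u. (\<forall>t\<in>insert z (b ` P). term_le X t u) \<longrightarrow> term_le X j u"
      using ex_join_term[of "insert z (b ` P)" X] by blast
    have "y \<sqsubseteq> ev j"
    proof (rule ccontr)
      assume "\<not> y \<sqsubseteq> ev j"
      then obtain p where p: "p \<sqsubseteq> y" "down_arrow L p (ev j)"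
        using ex_down_arrow[OF L(2) y ev_closed[OF j(1)]] by blast
      then have "p \<in> P" by (auto simp: P_def down_arrow_def)
      then have "p \<in> carrier L" "p \<sqsubseteq> ev (b p)" "term_le X (b p) j"
        using b j by (auto simp: is_least_def P_def)
      then have "p \<sqsubseteq> ev j" by (rule ev_trans)
      then show False using p by (simp add: down_arrow_def)
    qed
    moreover have "term_le X j t" if t: "t \<in> terms_over X" "y \<sqsubseteq> ev t" for t
    proof -
      have "term_le X (b p) t" if "p \<in> P" for p
      proof -
        have "p \<sqsubseteq> ev t" using that t(2) y ev_closed[OF t(1)] le_trans[of p y] by (simp add: P_def)
        then show ?thesis using b[OF that] t(1) by (simp add: is_least_def)
      qed
      then show ?thesis using j bottom[OF t(1)] by blast
    qed
    ultimately have "is_least y j" using j(1) by (simp add: is_least_def)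
    then show ?thesis by blast
  qed
  moreover have "ev b = y" if b: "is_least y b" and y: "y \<in> carrier L" for y b
  proof -
    obtain x where x: "x \<in> X" "g x = y" using gX y by (metis imageE)
    then have "term_le X b (Gen x)" using b y by (simp add: is_least_def ev_def Gen_terms)
    then have "ev b \<sqsubseteq> y" using ev_mono[of b "Gen x"] x by (simp add: ev_def)
    then show ?thesis using b y le_antisym[OF _ _ ev_closed[of b] y] by (simp add: is_least_def)
  qed
  ultimately have "\<forall>y\<in>carrier L. \<exists>b\<in>terms_over X. ev b = y \<and>
      (\<forall>t\<in>terms_over X. y \<sqsubseteq> ev t \<longrightarrow> term_le X b t)"
    unfolding is_least_def by metis
  then show ?thesis
    unfolding lower_bounded_lattice_iff ev_def using L X g
    by (intro conjI exI[of _ X] exI[of _ g])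
qed

section \<open>The components of the poset of covers\<close>

lemma (in partial_order) Cov_iff:
  "\<delta> \<in> Cov L \<longleftrightarrow> fst \<delta> \<in> carrier L \<and> snd \<delta> \<in> carrier L \<and> fst \<delta> \<sqsubseteq> snd \<delta> \<and> \<not> snd \<delta> \<sqsubseteq> fst \<delta> \<and>
    (\<forall>c\<in>carrier L. fst \<delta> \<sqsubseteq> c \<longrightarrow> c \<sqsubseteq> snd \<delta> \<longrightarrow> c = fst \<delta> \<or> c = snd \<delta>)"
  by (cases \<delta>) (auto simp: Cov_def lless_def eq_is_equal dest: le_antisym)

text \<open>In a semidistributive lattice every component of \<open>Cov L\<close> is of the following form, with
  \<open>(j0, j)\<close> its least element and \<open>m\<close> the first entry of its greatest element.\<close>

locale cover_class = lattice L for L (structure) +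
  fixes j0 j m
  assumes finite_carrier: "finite (carrier L)"
    and closed [simp]: "j0 \<in> carrier L" "j \<in> carrier L" "m \<in> carrier L"
    and j0_le_m: "j0 \<sqsubseteq> m" and j_not_le_m: "\<not> j \<sqsubseteq> m"
    and dichotomy: "\<lbrakk>x \<in> carrier L; j0 \<sqsubseteq> x; \<not> j \<sqsubseteq> x\<rbrakk> \<Longrightarrow> x \<sqsubseteq> m"
begin

text \<open>The three inequalities are those of \<open>Cov_le L (j0, j) \<delta>\<close>.\<close>

definition covers :: "('a \<times> 'a) set"
  where "covers = {\<delta> \<in> Cov L. j0 \<sqsubseteq> fst \<delta> \<and> \<not> j \<sqsubseteq> fst \<delta> \<and> j \<sqsubseteq> snd \<delta>}"

definition cover_poset :: "('a \<times> 'a) gorder"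
  where "cover_poset = (Cov_poset L)\<lparr>carrier := covers\<rparr>"

text \<open>The map \<open>push\<close> is left adjoint to \<open>fst\<close>, seen as a map from \<open>cover_poset\<close> to the interval
  from \<open>j0\<close> to \<open>m\<close>.\<close>

definition push :: "'a \<Rightarrow> 'a \<times> 'a"
  where "push a = ((a \<squnion> j) \<sqinter> m, a \<squnion> j)"

lemma carrier_cover_poset [simp]: "carrier cover_poset = covers"
  and le_cover_poset [simp]: "le cover_poset = Cov_le L"
  and eq_cover_poset [simp]: "eq cover_poset = (=)"
  by (simp_all add: cover_poset_def Cov_poset_def)

text \<open>\<open>fst \<delta> \<squnion> j\<close> and \<open>snd \<delta> \<sqinter> m\<close>
  lie between the entries of the cover, hence equal one of them; \<open>j\<close>, which is below
  neither \<open>fst \<delta>\<close> nor \<open>m\<close>, decides which. So each entry determines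
  the other.\<close>

lemma
  assumes "\<delta> \<in> covers"
  shows coversD: "fst \<delta> \<in> carrier L" "snd \<delta> \<in> carrier L" "j0 \<sqsubseteq> fst \<delta>" "fst \<delta> \<sqsubseteq> m" "\<not> j \<sqsubseteq> fst \<delta>"
    and covers_eq: "snd \<delta> = fst \<delta> \<squnion> j" "fst \<delta> = snd \<delta> \<sqinter> m"
proof -
  have cov: "fst \<delta> \<in> carrier L" "snd \<delta> \<in> carrier L" "fst \<delta> \<sqsubseteq> snd \<delta>"
    "\<And>c. \<lbrakk>c \<in> carrier L; fst \<delta> \<sqsubseteq> c; c \<sqsubseteq> snd \<delta>\<rbrakk> \<Longrightarrow> c = fst \<delta> \<or> c = snd \<delta>"
    and j: "j0 \<sqsubseteq> fst \<delta>" "\<not> j \<sqsubseteq> fst \<delta>" "j \<sqsubseteq> snd \<delta>"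
    using assms by (auto simp: covers_def Cov_iff)
  show m: "fst \<delta> \<sqsubseteq> m" using dichotomy cov j by blast
  have "fst \<delta> \<squnion> j = fst \<delta> \<or> fst \<delta> \<squnion> j = snd \<delta>"
    using cov j by (intro cov(4)) (simp_all add: join_left join_le)
  moreover have "fst \<delta> \<squnion> j \<noteq> fst \<delta>" using join_right[OF cov(1) closed(2)] j(2) by auto
  ultimately show "snd \<delta> = fst \<delta> \<squnion> j" by simp
  have "snd \<delta> \<sqinter> m = fst \<delta> \<or> snd \<delta> \<sqinter> m = snd \<delta>"
    using cov m by (intro cov(4)) (simp_all add: meet_left meet_le)
  moreover have "snd \<delta> \<sqinter> m \<noteq> snd \<delta>"
    using meet_right[OF cov(2) closed(3)] le_trans[OF j(3)] j_not_le_m cov(2) by fastforce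
  ultimately show "fst \<delta> = snd \<delta> \<sqinter> m" by simp
qed (use assms in \<open>simp_all add: covers_def Cov_iff\<close>)

text \<open>Reduces the order of covers to that of \<open>L\<close>: \<open>snd \<delta>\<close> is
  \<open>fst \<delta> \<squnion> j\<close> and so monotone in \<open>fst \<delta>\<close>, and
  \<open>j\<close> shows that \<open>snd \<delta>\<close> is not below
  \<open>fst \<epsilon>\<close>.\<close>

lemma Cov_le_covers:
  assumes "\<delta> \<in> covers" "\<epsilon> \<in> covers"
  shows "Cov_le L \<delta> \<epsilon> \<longleftrightarrow> fst \<delta> \<sqsubseteq> fst \<epsilon>"
proof
  assume le: "fst \<delta> \<sqsubseteq> fst \<epsilon>"
  note \<delta> = coversD[OF assms(1)] and \<epsilon> = coversD[OF assms(2)]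
  have "j \<sqsubseteq> snd \<delta>" "j \<sqsubseteq> snd \<epsilon>" "fst \<epsilon> \<sqsubseteq> snd \<epsilon>"
    using assms by (auto simp: covers_def Cov_iff)
  moreover from this have "\<not> snd \<delta> \<sqsubseteq> fst \<epsilon>" using \<delta> \<epsilon> le_trans[of j "snd \<delta>" "fst \<epsilon>"] by auto
  moreover have "snd \<delta> \<sqsubseteq> snd \<epsilon>"
    unfolding covers_eq(1)[OF assms(1)] using \<delta> \<epsilon> calculation le_trans[OF le]
    by (intro join_le) simp_all
  ultimately show "Cov_le L \<delta> \<epsilon>" using le by (simp add: Cov_le_def)
qed (simp add: Cov_le_def)

lemma le_push: "\<lbrakk>a \<in> carrier L; a \<sqsubseteq> m\<rbrakk> \<Longrightarrow> a \<sqsubseteq> fst (push a)"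
  by (simp add: push_def meet_le join_left)

text \<open>An element between the two entries is either above \<open>j\<close>, and then equal to
  \<open>a \<squnion> j\<close>, or below \<open>m\<close> by \<open>dichotomy\<close>, and then
  equal to the lower entry.\<close>

lemma push_covers:
  assumes a: "a \<in> carrier L" "j0 \<sqsubseteq> a" "a \<sqsubseteq> m"
  shows "push a \<in> covers"
proof -
  let ?w = "a \<squnion> j"
  let ?z = "?w \<sqinter> m"
  have w: "?w \<in> carrier L" and z: "?z \<in> carrier L" using a by simp_all
  have jw: "j \<sqsubseteq> ?w" and zw: "?z \<sqsubseteq> ?w" and zm: "?z \<sqsubseteq> m"
    using a by (simp_all add: join_right meet_left meet_right)
  have az: "a \<sqsubseteq> ?z" using le_push[OF a(1,3)] by (simp add: push_def)
  have jz: "\<not> j \<sqsubseteq> ?z" using zm j_not_le_m z le_trans[of j ?z m] by auto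
  have j0z: "j0 \<sqsubseteq> ?z" using az a z le_trans[of j0 a ?z] by simp
  have "u = ?z \<or> u = ?w" if u: "u \<in> carrier L" "?z \<sqsubseteq> u" "u \<sqsubseteq> ?w" for u
  proof (cases "j \<sqsubseteq> u")
    case True
    have "a \<sqsubseteq> u" using az u a z le_trans[of a ?z u] by simp
    then have "?w \<sqsubseteq> u" using True a u by (simp add: join_le)
    then show ?thesis using u w le_antisym by blast
  next
    case False
    have "j0 \<sqsubseteq> u" using j0z u z le_trans[of j0 ?z u] by simp
    then have "u \<sqsubseteq> m" using dichotomy u False by blast
    then have "u \<sqsubseteq> ?z" using u w by (simp add: meet_le)
    then show ?thesis using u z le_antisym by blast
  qed
  moreover have "\<not> ?w \<sqsubseteq> ?z" using jz jw w z le_trans[of j ?w ?z] by auto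
  ultimately show ?thesis using w z zw j0z jz jw by (simp add: covers_def Cov_iff push_def)
qed

text \<open>The adjunction: \<open>a \<sqsubseteq> fst \<delta>\<close> gives
  \<open>a \<squnion> j \<sqsubseteq> snd \<delta>\<close>, and meeting with \<open>m\<close> leads
  back to \<open>fst \<delta> = snd \<delta> \<sqinter> m\<close>.\<close>

lemma push_le_iff:
  assumes a: "a \<in> carrier L" "a \<sqsubseteq> m" and \<delta>: "\<delta> \<in> covers"
  shows "fst (push a) \<sqsubseteq> fst \<delta> \<longleftrightarrow> a \<sqsubseteq> fst \<delta>"
proof
  note \<delta> = coversD[OF \<delta>]
  have p: "fst (push a) \<in> carrier L" using a by (simp add: push_def)
  show "a \<sqsubseteq> fst \<delta>" if "fst (push a) \<sqsubseteq> fst \<delta>"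
    using le_trans[OF le_push[OF a] that] a p \<delta> by simp
  assume le: "a \<sqsubseteq> fst \<delta>"
  have "a \<sqsubseteq> snd \<delta>" "j \<sqsubseteq> snd \<delta>"
    unfolding covers_eq(1)[OF assms(3)] using a \<delta> le_trans[OF le join_left] by (simp_all add: join_right)
  then have "a \<squnion> j \<sqsubseteq> snd \<delta>" using a \<delta> by (simp add: join_le)
  then have "(a \<squnion> j) \<sqinter> m \<sqsubseteq> snd \<delta> \<sqinter> m"
    using a \<delta>(2) le_trans[OF meet_left, of "a \<squnion> j" m "snd \<delta>"]
    by (intro meet_le) (simp_all add: meet_right)
  then show "fst (push a) \<sqsubseteq> fst \<delta>" using covers_eq(2)[OF assms(3)] by (simp add: push_def)
qed

lemma le_push_iff:
  assumes "p \<in> carrier L" "p \<sqsubseteq> m" "a \<in> carrier L"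
  shows "p \<sqsubseteq> fst (push a) \<longleftrightarrow> p \<sqsubseteq> a \<squnion> j"
  using assms le_trans[of p "(a \<squnion> j) \<sqinter> m" "a \<squnion> j"]
  by (auto simp: push_def meet_left intro: meet_le)

section \<open>The lattice structure of the component\<close>

lemma partial_order_cover_poset: "partial_order cover_poset"
proof
  note cov = Cov_le_covers coversD(1)
  show "x .=\<^bsub>cover_poset\<^esub> y" if "x \<sqsubseteq>\<^bsub>cover_poset\<^esub> y" "y \<sqsubseteq>\<^bsub>cover_poset\<^esub> x" "x \<in> carrier cover_poset"
    "y \<in> carrier cover_poset" for x y
  proof -
    have "fst x = fst y" using that by (simp add: cov le_antisym)
    then show ?thesis using that covers_eq(1)[of x] covers_eq(1)[of y] by (simp add: prod_eq_iff)
  qed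
  show "x \<sqsubseteq>\<^bsub>cover_poset\<^esub> z" if "x \<sqsubseteq>\<^bsub>cover_poset\<^esub> y" "y \<sqsubseteq>\<^bsub>cover_poset\<^esub> z"
    "x \<in> carrier cover_poset" "y \<in> carrier cover_poset" "z \<in> carrier cover_poset" for x y z
    using that le_trans[of "fst x" "fst y" "fst z"] by (simp add: cov)
qed (simp_all add: Cov_le_covers coversD(1))

lemma bounds_closed:
  assumes "\<delta> \<in> covers" "\<epsilon> \<in> covers"
  shows "push (fst \<delta> \<squnion> fst \<epsilon>) \<in> covers" "push (fst \<delta> \<sqinter> fst \<epsilon>) \<in> covers"
    "fst \<delta> \<squnion> fst \<epsilon> \<in> carrier L" "fst \<delta> \<sqinter> fst \<epsilon> \<in> carrier L"
    "fst \<delta> \<squnion> fst \<epsilon> \<sqsubseteq> m" "fst \<delta> \<sqinter> fst \<epsilon> \<sqsubseteq> m"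
proof -
  note \<delta> = coversD[OF assms(1)] and \<epsilon> = coversD[OF assms(2)]
  show car: "fst \<delta> \<squnion> fst \<epsilon> \<in> carrier L" "fst \<delta> \<sqinter> fst \<epsilon> \<in> carrier L" using \<delta> \<epsilon> by simp_all
  show le: "fst \<delta> \<squnion> fst \<epsilon> \<sqsubseteq> m" using \<delta>(1,4) \<epsilon>(1,4) by (simp add: join_le)
  show ge: "fst \<delta> \<sqinter> fst \<epsilon> \<sqsubseteq> m"
    using le_trans[OF meet_left[OF \<delta>(1) \<epsilon>(1)] \<delta>(4)] \<delta>(1) \<epsilon>(1) by simp
  have "j0 \<sqsubseteq> fst \<delta> \<squnion> fst \<epsilon>"
    using le_trans[OF \<delta>(3) join_left[OF \<delta>(1) \<epsilon>(1)]] \<delta>(1) \<epsilon>(1) by simp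
  then show "push (fst \<delta> \<squnion> fst \<epsilon>) \<in> covers" by (rule push_covers[OF car(1) _ le])
  have "j0 \<sqsubseteq> fst \<delta> \<sqinter> fst \<epsilon>" using \<delta>(1,3) \<epsilon>(1,3) by (simp add: meet_le)
  then show "push (fst \<delta> \<sqinter> fst \<epsilon>) \<in> covers" by (rule push_covers[OF car(2) _ ge])
qed

text \<open>By the adjunction \<open>fst (push a)\<close> is a closure of \<open>a\<close> in the
  interval from \<open>j0\<close> to \<open>m\<close>, with the first entries of
  \<open>covers\<close> as closed elements. So bounds are formed in \<open>L\<close> on first
  entries and then closed by \<open>push\<close>.\<close>

lemma lattice_cover_poset: "lattice cover_poset"
proof -
  interpret K: partial_order cover_poset by (rule partial_order_cover_poset)
  show ?thesis
  proof
    fix x y assume "x \<in> carrier cover_poset" "y \<in> carrier cover_poset"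
    then have xy: "x \<in> covers" "y \<in> covers" by simp_all
    note b = bounds_closed[OF this] and x = coversD[OF xy(1)] and y = coversD[OF xy(2)]
    have le: "fst x \<sqsubseteq> fst (push (fst x \<squnion> fst y))" "fst y \<sqsubseteq> fst (push (fst x \<squnion> fst y))"
      using le_trans[OF join_left le_push[OF b(3,5)]] le_trans[OF join_right le_push[OF b(3,5)]]
        x(1) y(1) coversD(1)[OF b(1)] by simp_all
    have "least cover_poset (push (fst x \<squnion> fst y)) (Upper cover_poset {x, y})"
    proof (rule least_UpperI)
      fix z assume "z \<in> Upper cover_poset {x, y}"
      then have z: "z \<in> covers" "fst x \<sqsubseteq> fst z" "fst y \<sqsubseteq> fst z"
        using xy by (auto simp: Upper_def Cov_le_covers simp del: split_paired_All)
      then show "push (fst x \<squnion> fst y) \<sqsubseteq>\<^bsub>cover_poset\<^esub> z"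
        using b x(1) y(1) coversD(1)[OF z(1)]
        by (simp add: Cov_le_covers push_le_iff join_le)
    qed (use xy b le in \<open>auto simp: Cov_le_covers\<close>)
    then show "\<exists>s. least cover_poset s (Upper cover_poset {x, y})" by blast
    have ge: "fst (push (fst x \<sqinter> fst y)) \<sqsubseteq> fst x" "fst (push (fst x \<sqinter> fst y)) \<sqsubseteq> fst y"
      using x(1) y(1) b(4,6) xy by (simp_all add: push_le_iff meet_left meet_right)
    have "greatest cover_poset (push (fst x \<sqinter> fst y)) (Lower cover_poset {x, y})"
    proof (rule greatest_LowerI)
      fix z assume "z \<in> Lower cover_poset {x, y}"
      then have z: "z \<in> covers" "fst z \<sqsubseteq> fst x" "fst z \<sqsubseteq> fst y"
        using xy by (auto simp: Lower_def Cov_le_covers simp del: split_paired_All)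
      then have "fst z \<sqsubseteq> fst x \<sqinter> fst y" using x(1) y(1) coversD(1)[OF z(1)] by (simp add: meet_le)
      then have "fst z \<sqsubseteq> fst (push (fst x \<sqinter> fst y))"
        using le_trans[OF _ le_push[OF b(4,6)]] b(4) coversD(1)[OF z(1)] coversD(1)[OF b(2)] by simp
      then show "z \<sqsubseteq>\<^bsub>cover_poset\<^esub> push (fst x \<sqinter> fst y)"
        using b z by (simp add: Cov_le_covers)
    qed (use xy b ge in \<open>auto simp: Cov_le_covers\<close>)
    then show "\<exists>s. greatest cover_poset s (Lower cover_poset {x, y})" by blast
  qed
qed

lemma finite_cover_poset: "finite (carrier cover_poset)"
  by (rule finite_subset[of _ "carrier L \<times> carrier L"])
    (auto simp: covers_def Cov_def finite_carrier)

section \<open>Join dependency in the component\<close>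

text \<open>A join irreducible \<open>P\<close> of \<open>cover_poset\<close> is generated by some join irreducible \<open>q\<close> of \<open>L\<close>, and
  the dependency relation among such \<open>P\<close> maps into that among these \<open>q\<close>.\<close>

definition generates :: "'a \<Rightarrow> 'a \<times> 'a \<Rightarrow> bool"
  where "generates q P \<longleftrightarrow> q \<in> carrier L \<and> q \<sqsubseteq> fst P \<and> (\<exists>e. down_arrow L q e) \<and>
    push (q \<squnion> j0) = P \<and> (\<forall>r\<in>carrier L. r \<sqsubseteq> q \<longrightarrow> r \<noteq> q \<longrightarrow> push (r \<squnion> j0) \<noteq> P)"

text \<open>Joining with \<open>j0\<close> moves any \<open>q\<close> below \<open>m\<close> into
  the interval where the adjunction applies, without changing which \<open>fst \<delta>\<close> lie
  above it.\<close>

lemma push_join_j0: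
  assumes "q \<in> carrier L" "q \<sqsubseteq> m"
  shows "push (q \<squnion> j0) \<in> covers"
    and "\<delta> \<in> covers \<Longrightarrow> Cov_le L (push (q \<squnion> j0)) \<delta> \<longleftrightarrow> q \<sqsubseteq> fst \<delta>"
proof -
  have q: "q \<squnion> j0 \<in> carrier L" "j0 \<sqsubseteq> q \<squnion> j0" "q \<squnion> j0 \<sqsubseteq> m" "q \<sqsubseteq> q \<squnion> j0"
    using assms j0_le_m by (simp_all add: join_left join_right join_le)
  show push: "push (q \<squnion> j0) \<in> covers" by (rule push_covers[OF q(1-3)])
  assume \<delta>: "\<delta> \<in> covers"
  have "q \<squnion> j0 \<sqsubseteq> fst \<delta> \<longleftrightarrow> q \<sqsubseteq> fst \<delta>"
    using le_trans[OF q(4), of "fst \<delta>"] assms(1) q(1) coversD(1,3)[OF \<delta>]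
    by (auto intro: join_le)
  then show "Cov_le L (push (q \<squnion> j0)) \<delta> \<longleftrightarrow> q \<sqsubseteq> fst \<delta>"
    using \<delta> push q by (simp add: Cov_le_covers push_le_iff)
qed

text \<open>A minimal \<open>q\<close> below \<open>fst P\<close> and not below \<open>fst E\<close>
  works. Its image is below \<open>P\<close> but not below \<open>E\<close>, so it is
  \<open>P\<close> by minimality of \<open>P\<close>; smaller elements are below
  \<open>fst E\<close> and have images below \<open>E\<close>.\<close>

lemma ex_generates:
  assumes P: "down_arrow cover_poset P E"
  shows "\<exists>q. generates q P"
proof -
  have PE: "P \<in> covers" "E \<in> covers" "\<not> fst P \<sqsubseteq> fst E"
    and min: "\<And>R. \<lbrakk>R \<in> covers; Cov_le L R P; R \<noteq> P\<rbrakk> \<Longrightarrow> Cov_le L R E"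
    using P by (auto simp: down_arrow_def Cov_le_covers)
  note P = coversD[OF PE(1)] and E = coversD[OF PE(2)]
  obtain q where q: "q \<sqsubseteq> fst P" "down_arrow L q (fst E)"
    using ex_down_arrow[OF finite_carrier P(1) E(1) PE(3)] by blast
  then have qc: "q \<in> carrier L" "\<not> q \<sqsubseteq> fst E" by (auto simp: down_arrow_def)
  have qm: "q \<sqsubseteq> m" using le_trans[OF q(1) P(4)] qc P(1) by simp
  have "push (q \<squnion> j0) = P"
    using min[of "push (q \<squnion> j0)"] push_join_j0[OF qc(1) qm] q qc PE by blast
  moreover have "push (r \<squnion> j0) \<noteq> P" if r: "r \<in> carrier L" "r \<sqsubseteq> q" "r \<noteq> q" for r
  proof
    assume eq: "push (r \<squnion> j0) = P"
    have "r \<sqsubseteq> fst E" using q r by (simp add: down_arrow_def)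
    moreover have "r \<sqsubseteq> m" using le_trans[OF r(2) qm] r qc by simp
    ultimately have "Cov_le L P E" using push_join_j0(2)[OF r(1) _ PE(2)] eq by simp
    then show False using PE by (simp add: Cov_le_covers)
  qed
  ultimately show ?thesis using q qc unfolding generates_def by blast
qed

text \<open>The two claims amount to \<open>down_arrow L r (fst C)\<close>. An element strictly
  below \<open>r\<close> has its image strictly below \<open>R\<close>, hence below
  \<open>C\<close>.\<close>

lemma generates_down_arrow:
  assumes r: "generates r R" and R: "down_arrow cover_poset R C"
  shows "\<not> r \<sqsubseteq> fst C" and "\<lbrakk>s \<in> carrier L; s \<sqsubseteq> r; s \<noteq> r\<rbrakk> \<Longrightarrow> s \<sqsubseteq> fst C"
proof -
  have RC: "R \<in> covers" "C \<in> covers" "\<not> Cov_le L R C"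
    and min: "\<And>S. \<lbrakk>S \<in> covers; Cov_le L S R; S \<noteq> R\<rbrakk> \<Longrightarrow> Cov_le L S C"
    using R by (auto simp: down_arrow_def)
  have rc: "r \<in> carrier L" "r \<sqsubseteq> fst R" "push (r \<squnion> j0) = R"
    using r by (simp_all add: generates_def)
  have rm: "r \<sqsubseteq> m" using le_trans[OF rc(2) coversD(4)[OF RC(1)]] rc coversD(1)[OF RC(1)] by simp
  show "\<not> r \<sqsubseteq> fst C" using push_join_j0(2)[OF rc(1) rm RC(2)] rc RC by simp
  assume s: "s \<in> carrier L" "s \<sqsubseteq> r" "s \<noteq> r"
  have sm: "s \<sqsubseteq> m" using le_trans[OF s(2) rm] s rc by simp
  have "s \<sqsubseteq> fst R" using le_trans[OF s(2) rc(2)] s rc coversD(1)[OF RC(1)] by simp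
  moreover have "push (s \<squnion> j0) \<noteq> R" using r s by (simp add: generates_def)
  ultimately have "Cov_le L (push (s \<squnion> j0)) C"
    using min push_join_j0[OF s(1) sm] RC by blast
  then show "s \<sqsubseteq> fst C" using push_join_j0(2)[OF s(1) sm RC(2)] by simp
qed

text \<open>The witness \<open>c\<close> is taken above \<open>snd C\<close> and maximal among
  elements not above \<open>p\<close>. Elements strictly below \<open>r\<close> are below
  \<open>fst C\<close>, hence below \<open>c\<close>; the point is that \<open>r\<close> itself is
  not.\<close>

lemma generates_dependency:
  assumes p: "generates p P" and r: "generates r R"
    and P: "up_arrow cover_poset P C" and R: "down_arrow cover_poset R C"
  shows "\<exists>c. up_arrow L p c \<and> down_arrow L r c"
proof -
  have cov: "P \<in> covers" "R \<in> covers" "C \<in> covers" and PC: "\<not> Cov_le L P C"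
    and max: "\<And>D. \<lbrakk>D \<in> covers; Cov_le L C D; D \<noteq> C\<rbrakk> \<Longrightarrow> Cov_le L P D"
    using P R by (auto simp: down_arrow_def up_arrow_def)
  note P = coversD[OF cov(1)] and R = coversD[OF cov(2)] and C = coversD[OF cov(3)]
  have pc: "p \<in> carrier L" "p \<sqsubseteq> fst P" "push (p \<squnion> j0) = P"
    and rc: "r \<in> carrier L" "r \<sqsubseteq> fst R" using p r by (simp_all add: generates_def)
  note r_C = generates_down_arrow[OF r \<open>down_arrow cover_poset R C\<close>]
  have pm: "p \<sqsubseteq> m" using le_trans[OF pc(2) P(4)] pc P(1) by simp
  have rm: "r \<sqsubseteq> m" using le_trans[OF rc(2) R(4)] rc R(1) by simp
  have p_C: "\<not> p \<sqsubseteq> fst C" using push_join_j0(2)[OF pc(1) pm cov(3)] pc PC by simp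
  \<comment> \<open>Otherwise \<open>p\<close>, being below \<open>m\<close>, would be below
    \<open>snd C \<sqinter> m = fst C\<close>.\<close>
  have "\<not> p \<sqsubseteq> snd C" using p_C pm pc(1) C(1,2) meet_le[of p "snd C" m]
    by (auto simp: covers_eq(2)[OF cov(3), symmetric])
  then obtain c where c: "snd C \<sqsubseteq> c" "up_arrow L p c"
    using ex_up_arrow[OF finite_carrier pc(1) C(2)] by blast
  then have cc: "c \<in> carrier L" "\<not> p \<sqsubseteq> c" by (auto simp: up_arrow_def)
  have Cc: "fst C \<sqsubseteq> c" "j \<sqsubseteq> c"
    using le_trans[OF _ c(1), of "fst C"] le_trans[OF _ c(1), of j] C(1,2) cc
      join_left[OF C(1) closed(2)] join_right[OF C(1) closed(2)]
    by (simp_all add: covers_eq(1)[OF cov(3), symmetric])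
  have "\<not> r \<sqsubseteq> c"
  proof
    assume "r \<sqsubseteq> c"
    \<comment> \<open>The image of this element is strictly above \<open>C\<close>, so maximality of
      \<open>C\<close> puts \<open>P\<close> below it. Then \<open>p\<close> is below
      \<open>r \<squnion> fst C \<squnion> j\<close>, whose three parts are all below
      \<open>c\<close>.\<close>
    let ?a = "r \<squnion> fst C"
    have a: "?a \<in> carrier L" "j0 \<sqsubseteq> ?a" "?a \<sqsubseteq> m" "fst C \<sqsubseteq> ?a" "r \<sqsubseteq> ?a"
      using rc(1) rm C(1,3,4) le_trans[OF C(3) join_right[OF rc(1) C(1)]]
      by (simp_all add: join_le join_left join_right)
    let ?D = "push ?a"
    have D: "?D \<in> covers" by (rule push_covers[OF a(1-3)])
    have le: "fst C \<sqsubseteq> fst ?D" "r \<sqsubseteq> fst ?D"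
      using le_trans[OF a(4) le_push[OF a(1,3)]] le_trans[OF a(5) le_push[OF a(1,3)]]
        C(1) rc(1) a(1) coversD(1)[OF D] by simp_all
    then have "?D \<noteq> C" using r_C(1) by auto
    then have "Cov_le L P ?D" using max[OF D] le cov D by (simp add: Cov_le_covers)
    then have "p \<sqsubseteq> fst ?D" using push_join_j0(2)[OF pc(1) pm D] pc by simp
    then have "p \<sqsubseteq> ?a \<squnion> j" using le_push_iff[OF pc(1) pm a(1)] by simp
    moreover have "?a \<squnion> j \<sqsubseteq> c"
      using \<open>r \<sqsubseteq> c\<close> Cc rc(1) C(1) cc(1) by (simp add: join_le)
    ultimately show False using le_trans[of p "?a \<squnion> j" c] pc(1) a(1) cc by simp
  qed
  moreover have "s \<sqsubseteq> c" if "s \<in> carrier L" "s \<sqsubseteq> r" "s \<noteq> r" for s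
    using le_trans[OF r_C(2)[OF that] Cc(1)] that C(1) cc(1) by simp
  ultimately have "down_arrow L r c" using rc cc by (simp add: down_arrow_def)
  then show ?thesis using c by blast
qed

lemma dependency_ranked_cover_poset:
  assumes "dependency_ranked L"
  shows "dependency_ranked cover_poset"
proof -
  obtain \<rho> where \<rho>: "dependency_rank L \<rho>" using assms by (auto simp: dependency_ranked_def)
  define q where "q P = (SOME q. generates q P)" for P
  have q: "generates (q P) P" if "down_arrow cover_poset P E" for P E
    unfolding q_def using ex_generates[OF that] by (rule someI_ex)
  have "\<rho> (q R) < \<rho> (q P)"
    if P: "down_arrow cover_poset P E" "up_arrow cover_poset P C"
      and R: "down_arrow cover_poset R C" and "P \<noteq> R" for P R C E
  proof -
    obtain c where c: "up_arrow L (q P) c" "down_arrow L (q R) c"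
      using generates_dependency[OF q[OF P(1)] q[OF R] P(2) R] by blast
    \<comment> \<open>\<open>P\<close> is recovered from its generating element as
      \<open>push (q P \<squnion> j0)\<close>.\<close>
    have "q P \<noteq> q R" using q[OF P(1)] q[OF R] \<open>P \<noteq> R\<close> by (auto simp: generates_def)
    then show ?thesis using dependency_rankD[OF \<rho> _ c] q[OF P(1)] by (auto simp: generates_def)
  qed
  then have "dependency_rank cover_poset (\<lambda>P. \<rho> (q P))"
    unfolding dependency_rank_def by blast
  then show ?thesis unfolding dependency_ranked_def by blast
qed

end

section \<open>Recognizing the components in a semidistributive lattice\<close>

lemma lattice_inv_gorder:
  assumes "lattice L"
  shows "lattice (inv_gorder L)"
proof -
  interpret lattice L by fact
  interpret dual: partial_order "inv_gorder L" by (rule dual_order)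
  show ?thesis by unfold_locales (simp_all add: sup_of_two_exists inf_of_two_exists)
qed

lemma (in lattice) Cov_join_eq:
  assumes "\<delta> \<in> Cov L" "x \<in> carrier L" "x \<sqsubseteq> snd \<delta>" "\<not> x \<sqsubseteq> fst \<delta>"
  shows "fst \<delta> \<squnion> x = snd \<delta>"
proof -
  have \<delta>: "fst \<delta> \<in> carrier L" "snd \<delta> \<in> carrier L" "fst \<delta> \<sqsubseteq> snd \<delta>"
    "\<And>c. \<lbrakk>c \<in> carrier L; fst \<delta> \<sqsubseteq> c; c \<sqsubseteq> snd \<delta>\<rbrakk> \<Longrightarrow> c = fst \<delta> \<or> c = snd \<delta>"
    using assms(1) unfolding Cov_iff by auto
  have "fst \<delta> \<squnion> x = fst \<delta> \<or> fst \<delta> \<squnion> x = snd \<delta>"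
    using \<delta>(1-3) assms(2,3) by (intro \<delta>(4)) (simp_all add: join_left join_le)
  then show ?thesis using join_right[OF \<delta>(1) assms(2)] assms(4) by auto
qed

text \<open>Meet semidistributivity shows that \<open>m\<close> bounds every element above
  \<open>j0\<close> and not above \<open>j\<close>. Join semidistributivity shows that the up-set of
  \<open>(j0, j)\<close> is closed downwards; being connected through its least element, it is then
  a whole component.\<close>

lemma Cov_component_eq_cover_poset:
  fixes L (structure)
  assumes L: "lattice L" "finite (carrier L)" "join_semidistributive L"
    "join_semidistributive (inv_gorder L)" and \<gamma>: "\<gamma> \<in> Cov L"
  shows "\<exists>j0 j m. cover_class L j0 j m \<and> Cov_component L \<gamma> = cover_class.cover_poset L j0 j"
proof -
  interpret lattice L by fact
  interpret Cov: partial_order "Cov_poset L" by (rule partial_order_Cov_poset) fact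
  have g: "fst \<gamma> \<in> carrier L" "snd \<gamma> \<in> carrier L" "\<not> snd \<gamma> \<sqsubseteq> fst \<gamma>"
    using \<gamma> by (auto simp: Cov_iff)
  obtain j where j: "j \<sqsubseteq> snd \<gamma>" "down_arrow L j (fst \<gamma>)"
    using ex_down_arrow[OF L(2) g(2,1,3)] by blast
  obtain m where m: "fst \<gamma> \<sqsubseteq> m" "up_arrow L (snd \<gamma>) m"
    using ex_up_arrow[OF L(2) g(2,1,3)] by blast
  have jc: "j \<in> carrier L" "\<not> j \<sqsubseteq> fst \<gamma>"
    and j_min: "\<And>x. \<lbrakk>x \<in> carrier L; x \<sqsubseteq> j; x \<noteq> j\<rbrakk> \<Longrightarrow> x \<sqsubseteq> fst \<gamma>"
    using j(2) by (auto simp: down_arrow_def)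
  have mc: "m \<in> carrier L" "\<not> snd \<gamma> \<sqsubseteq> m"
    and m_max: "\<And>x. \<lbrakk>x \<in> carrier L; m \<sqsubseteq> x; x \<noteq> m\<rbrakk> \<Longrightarrow> snd \<gamma> \<sqsubseteq> x"
    using m(2) by (auto simp: up_arrow_def)
  \<comment> \<open>Everything strictly below \<open>j\<close> is below \<open>fst \<gamma>\<close>,
    so this is the unique lower cover of \<open>j\<close>.\<close>
  define j0 where "j0 = j \<sqinter> fst \<gamma>"
  have j0: "j0 \<in> carrier L" "j0 \<sqsubseteq> j" "j0 \<sqsubseteq> fst \<gamma>"
    using jc g by (simp_all add: j0_def meet_left meet_right)
  have j0_m: "j0 \<sqsubseteq> m" using le_trans[OF j0(3) m(1)] j0(1) g(1) mc(1) by simp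
  have below_j: "x \<sqsubseteq> j0" if "x \<in> carrier L" "x \<sqsubseteq> j" "x \<noteq> j" for x
    using that j_min[OF that] jc(1) g(1) by (simp add: j0_def meet_le)
  have meet_j: "j \<sqinter> x = j0" if x: "x \<in> carrier L" "j0 \<sqsubseteq> x" "\<not> j \<sqsubseteq> x" for x
  proof (rule le_antisym)
    have "j \<sqinter> x \<noteq> j" using meet_right[OF jc(1) x(1)] x(3) by auto
    then show "j \<sqinter> x \<sqsubseteq> j0" using x(1) jc(1) by (intro below_j) (simp_all add: meet_left)
    show "j0 \<sqsubseteq> j \<sqinter> x" using x j0 jc(1) by (simp add: meet_le)
  qed (use x j0 jc in simp_all)
  have j_m: "\<not> j \<sqsubseteq> m"
  proof
    assume "j \<sqsubseteq> m"
    then have "fst \<gamma> \<squnion> j \<sqsubseteq> m" using m(1) g jc mc by (simp add: join_le)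
    then show False using Cov_join_eq[OF \<gamma> jc(1) j(1) jc(2)] mc(2) by simp
  qed
  interpret C: cover_class L j0 j m
  proof
    fix x assume x: "x \<in> carrier L" "j0 \<sqsubseteq> x" "\<not> j \<sqsubseteq> x"
    \<comment> \<open>Otherwise \<open>x \<squnion> m\<close> is above \<open>snd \<gamma>\<close>
      and so above \<open>j\<close>. Since \<open>j\<close> meets both \<open>x\<close> and
      \<open>m\<close> in \<open>j0\<close>, meet semidistributivity would put \<open>j\<close>
      below \<open>x\<close>.\<close>
    show "x \<sqsubseteq> m"
    proof (rule ccontr)
      assume "\<not> x \<sqsubseteq> m"
      then have "x \<squnion> m \<noteq> m" using join_left[OF x(1) mc(1)] by auto
      then have "snd \<gamma> \<sqsubseteq> x \<squnion> m" using x(1) mc(1) by (intro m_max) (simp_all add: join_right)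
      then have le: "j \<sqsubseteq> x \<squnion> m" using le_trans[OF j(1)] jc(1) g(2) x(1) mc(1) by simp
      have "j \<sqinter> x = j \<sqinter> m" using meet_j[OF x] meet_j[OF mc(1) j0_m j_m] by simp
      then have "j \<sqinter> (x \<squnion> m) = j \<sqinter> x"
        using L(4) jc(1) x(1) mc(1) unfolding join_semidistributive_def by simp
      then have "j \<sqinter> (x \<squnion> m) \<sqsubseteq> x" using meet_right[OF jc(1) x(1)] by simp
      moreover have "j \<sqsubseteq> j \<sqinter> (x \<squnion> m)" using le jc(1) x(1) mc(1) by (simp add: meet_le)
      ultimately show False using le_trans[of j "j \<sqinter> (x \<squnion> m)" x] x jc(1) mc(1) by simp
    qed
  qed (use L(2) j0 jc mc j0_m j_m in simp_all)
  have bottom: "(j0, j) \<in> Cov L"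
    using j0 jc below_j le_antisym[OF _ _ _ j0(1)] le_trans[OF _ j0(3) jc(1)]
    by (auto simp: Cov_iff g)
  have covers_iff: "\<delta> \<in> C.covers \<longleftrightarrow> \<delta> \<in> Cov L \<and> Cov_le L (j0, j) \<delta>" for \<delta>
    by (simp add: C.covers_def Cov_le_def)
  have down_closed: "\<epsilon> \<in> C.covers"
    if \<delta>: "\<delta> \<in> C.covers" and \<epsilon>: "\<epsilon> \<in> Cov L" "Cov_le L \<epsilon> \<delta>" for \<delta> \<epsilon>
  proof -
    have \<delta>C: "\<delta> \<in> Cov L" "j \<sqsubseteq> snd \<delta>" using \<delta> by (simp_all add: C.covers_def)
    note d = C.coversD[OF \<delta>]
    have e: "fst \<epsilon> \<in> carrier L" "snd \<epsilon> \<in> carrier L" "fst \<epsilon> \<sqsubseteq> snd \<epsilon>"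
      "\<And>c. \<lbrakk>c \<in> carrier L; fst \<epsilon> \<sqsubseteq> c; c \<sqsubseteq> snd \<epsilon>\<rbrakk> \<Longrightarrow> c = fst \<epsilon> \<or> c = snd \<epsilon>"
      using \<epsilon>(1) unfolding Cov_iff by auto
    have le: "fst \<epsilon> \<sqsubseteq> fst \<delta>" "\<not> snd \<epsilon> \<sqsubseteq> fst \<delta>" "snd \<epsilon> \<sqsubseteq> snd \<delta>"
      using \<epsilon>(2) by (simp_all add: Cov_le_def)
    have join_j: "fst \<delta> \<squnion> j = snd \<delta>" by (rule Cov_join_eq[OF \<delta>C(1) jc(1) \<delta>C(2) d(5)])
    have join_e: "fst \<delta> \<squnion> snd \<epsilon> = snd \<delta>" by (rule Cov_join_eq[OF \<delta>C(1) e(2) le(3,2)])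
    \<comment> \<open>\<open>j\<close> and \<open>snd \<epsilon>\<close> have the same join with
      \<open>fst \<delta>\<close>, so their meet has it too. The meet is therefore not below
      \<open>fst \<delta>\<close>, and so not strictly below \<open>j\<close>.\<close>
    have "fst \<delta> \<squnion> (j \<sqinter> snd \<epsilon>) = snd \<delta>"
      using L(3) d(1) jc(1) e(2) join_j join_e unfolding join_semidistributive_def by metis
    then have "\<not> j \<sqinter> snd \<epsilon> \<sqsubseteq> fst \<delta>"
      using join_le[of "j \<sqinter> snd \<epsilon>" "fst \<delta>" "fst \<delta>"] join_le[of "fst \<delta>" "fst \<delta>" "j \<sqinter> snd \<epsilon>"]
        d(1) jc(1) e(2) \<delta>C(1) by (auto simp: Cov_iff)
    then have "\<not> j \<sqinter> snd \<epsilon> \<sqsubseteq> j0"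
      using le_trans[OF _ d(3)] jc(1) e(2) j0(1) d(1) by auto
    then have "j \<sqinter> snd \<epsilon> = j" using below_j[of "j \<sqinter> snd \<epsilon>"] jc(1) e(2) meet_left by auto
    then have j_e: "j \<sqsubseteq> snd \<epsilon>" using meet_right[OF jc(1) e(2)] by simp
    have "fst \<delta> \<sqinter> snd \<epsilon> = fst \<epsilon> \<or> fst \<delta> \<sqinter> snd \<epsilon> = snd \<epsilon>"
      using d(1) e(1-3) le(1) by (intro e(4)) (simp_all add: meet_right meet_le)
    then have "fst \<delta> \<sqinter> snd \<epsilon> = fst \<epsilon>" using meet_left[OF d(1) e(2)] le(2) by auto
    moreover have "j0 \<sqsubseteq> fst \<delta> \<sqinter> snd \<epsilon>"
      using d(1,3) e(2) j0(1) le_trans[OF j0(2) j_e j0(1) jc(1) e(2)] by (simp add: meet_le)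
    moreover have "\<not> j \<sqsubseteq> fst \<epsilon>" using le_trans[OF _ le(1)] d(1,5) jc(1) e(1) by blast
    ultimately show ?thesis using \<epsilon>(1) j_e by (simp add: C.covers_def)
  qed
  have up_closed: "\<epsilon> \<in> C.covers" if "\<delta> \<in> C.covers" "\<epsilon> \<in> Cov L" "Cov_le L \<delta> \<epsilon>" for \<delta> \<epsilon>
    using that bottom Cov.le_trans[of "(j0, j)" \<delta> \<epsilon>] by (simp add: covers_iff Cov_poset_def)
  have \<gamma>C: "\<gamma> \<in> C.covers" using \<gamma> j j0 jc by (simp add: C.covers_def)
  let ?R = "comparability (Cov_poset L)"
  have "{\<delta> \<in> Cov L. (\<gamma>, \<delta>) \<in> ?R\<^sup>*} = C.covers"
  proof (intro subset_antisym subsetI)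
    fix \<delta> assume \<delta>: "\<delta> \<in> C.covers"
    have "(\<gamma>, (j0, j)) \<in> ?R" "((j0, j), \<delta>) \<in> ?R"
      using bottom \<gamma>C \<delta> by (simp_all add: comparability_def Cov_poset_def covers_iff)
    then show "\<delta> \<in> {\<delta> \<in> Cov L. (\<gamma>, \<delta>) \<in> ?R\<^sup>*}"
      using \<delta> by (auto simp: covers_iff intro: rtrancl.intros)
  next
    fix \<delta> assume "\<delta> \<in> {\<delta> \<in> Cov L. (\<gamma>, \<delta>) \<in> ?R\<^sup>*}"
    then have "(\<gamma>, \<delta>) \<in> ?R\<^sup>*" by simp
    then show "\<delta> \<in> C.covers"
    proof (induction rule: rtrancl_induct)
      case (step \<delta> \<epsilon>)
      then have "\<epsilon> \<in> Cov L" "Cov_le L \<delta> \<epsilon> \<or> Cov_le L \<epsilon> \<delta>"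
        by (auto simp: comparability_def Cov_poset_def)
      then show ?case using step.IH up_closed down_closed by blast
    qed (rule \<gamma>C)
  qed
  then have "Cov_component L \<gamma> = C.cover_poset"
    by (simp add: Cov_component_def C.cover_poset_def)
  then show ?thesis using C.cover_class_axioms by blast
qed

lemma Cov_component_dependency_ranked:
  assumes L: "lattice L" "finite (carrier L)" "dependency_ranked L"
    "dependency_ranked (inv_gorder L)" and \<gamma>: "\<gamma> \<in> Cov L"
  shows "lattice (Cov_component L \<gamma>) \<and> finite (carrier (Cov_component L \<gamma>)) \<and>
    dependency_ranked (Cov_component L \<gamma>)"
proof -
  have "join_semidistributive L" "join_semidistributive (inv_gorder L)"
    using L dependency_ranked_imp_join_semidistributive[of L]
      dependency_ranked_imp_join_semidistributive[OF lattice_inv_gorder[OF L(1)]] by simp_all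
  then obtain j0 j m where C: "cover_class L j0 j m"
    and eq: "Cov_component L \<gamma> = cover_class.cover_poset L j0 j"
    using Cov_component_eq_cover_poset[OF L(1,2) _ _ \<gamma>] by blast
  show ?thesis unfolding eq
    using cover_class.lattice_cover_poset[OF C] cover_class.finite_cover_poset[OF C]
      cover_class.dependency_ranked_cover_poset[OF C L(3)] by blast
qed

section \<open>Transport to the dual lattice\<close>

lemma dependency_ranked_iso:
  assumes "dependency_ranked K" and h: "bij_betw h (carrier M) (carrier K)"
    and le: "\<And>x y. \<lbrakk>x \<in> carrier M; y \<in> carrier M\<rbrakk> \<Longrightarrow> h x \<sqsubseteq>\<^bsub>K\<^esub> h y \<longleftrightarrow> x \<sqsubseteq>\<^bsub>M\<^esub> y"
  shows "dependency_ranked M"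
proof -
  obtain \<rho> where \<rho>: "dependency_rank K \<rho>" using assms(1) by (auto simp: dependency_ranked_def)
  have car: "carrier K = h ` carrier M" and inj: "inj_on h (carrier M)"
    using h by (simp_all add: bij_betw_def)
  have "down_arrow K (h q) (h c)" if "down_arrow M q c" for q c
    using that unfolding down_arrow_def car by (auto simp: le)
  moreover have "up_arrow K (h p) (h c)" if "up_arrow M p c" for p c
    using that unfolding up_arrow_def car by (auto simp: le)
  moreover have "h p \<noteq> h q" if "up_arrow M p c" "down_arrow M q d" "p \<noteq> q" for p q c d
    using that inj by (auto simp: up_arrow_def down_arrow_def inj_on_def)
  ultimately have "dependency_rank M (\<lambda>x. \<rho> (h x))"
    using dependency_rankD[OF \<rho>] unfolding dependency_rank_def by meson
  then show ?thesis by (auto simp: dependency_ranked_def)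
qed

lemma rtrancl_mapI:
  "\<lbrakk>(x, y) \<in> R\<^sup>*; \<And>x y. (x, y) \<in> R \<Longrightarrow> (f x, f y) \<in> S\<rbrakk> \<Longrightarrow> (f x, f y) \<in> S\<^sup>*"
  by (induction rule: rtrancl_induct) (auto intro: rtrancl.rtrancl_into_rtrancl)

text \<open>Exchanging the entries of covers reverses their order: the two positive inequalities
  change places, and the negated one is its own dual.\<close>

lemma Cov_component_inv_gorder:
  assumes "lattice L"
  shows "bij_betw prod.swap (carrier (Cov_component L \<gamma>))
      (carrier (Cov_component (inv_gorder L) (prod.swap \<gamma>)))"
    and "prod.swap \<delta> \<sqsubseteq>\<^bsub>Cov_component (inv_gorder L) (prod.swap \<gamma>)\<^esub> prod.swap \<epsilon> \<longleftrightarrow>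
      \<epsilon> \<sqsubseteq>\<^bsub>Cov_component L \<gamma>\<^esub> \<delta>"
proof -
  interpret lattice L by fact
  interpret dual: lattice "inv_gorder L" using assms by (rule lattice_inv_gorder)
  have Cov: "prod.swap \<delta> \<in> Cov (inv_gorder L) \<longleftrightarrow> \<delta> \<in> Cov L" for \<delta>
    unfolding Cov_iff dual.Cov_iff by auto
  have le: "Cov_le (inv_gorder L) (prod.swap \<delta>) (prod.swap \<epsilon>) \<longleftrightarrow> Cov_le L \<epsilon> \<delta>" for \<delta> \<epsilon>
    by (auto simp: Cov_le_def)
  let ?R = "comparability (Cov_poset L)" and ?R' = "comparability (Cov_poset (inv_gorder L))"
  have R: "(prod.swap \<delta>, prod.swap \<epsilon>) \<in> ?R' \<longleftrightarrow> (\<delta>, \<epsilon>) \<in> ?R" for \<delta> \<epsilon>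
    by (auto simp: comparability_def Cov_poset_def Cov le simp del: prod.swap_def)
  have R': "(prod.swap x, prod.swap y) \<in> ?R" if "(x, y) \<in> ?R'" for x y
    using R[of "prod.swap x" "prod.swap y"] that by simp
  have "(prod.swap \<delta>, prod.swap \<epsilon>) \<in> ?R'\<^sup>* \<longleftrightarrow> (\<delta>, \<epsilon>) \<in> ?R\<^sup>*" for \<delta> \<epsilon>
    using rtrancl_mapI[of \<delta> \<epsilon> ?R prod.swap ?R']
      rtrancl_mapI[of "prod.swap \<delta>" "prod.swap \<epsilon>" ?R' prod.swap ?R] R R'
    by (simp only: swap_swap) blast
  then have car: "prod.swap \<delta> \<in> carrier (Cov_component (inv_gorder L) (prod.swap \<gamma>)) \<longleftrightarrow>
      \<delta> \<in> carrier (Cov_component L \<gamma>)" for \<delta>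
    by (simp add: Cov_component_def Cov)
  show "bij_betw prod.swap (carrier (Cov_component L \<gamma>))
      (carrier (Cov_component (inv_gorder L) (prod.swap \<gamma>)))"
    by (rule bij_betw_byWitness[where f' = prod.swap]) (use car in \<open>force simp: image_subset_iff\<close>)+
  show "prod.swap \<delta> \<sqsubseteq>\<^bsub>Cov_component (inv_gorder L) (prod.swap \<gamma>)\<^esub> prod.swap \<epsilon> \<longleftrightarrow>
      \<epsilon> \<sqsubseteq>\<^bsub>Cov_component L \<gamma>\<^esub> \<delta>"
    using le by (simp add: Cov_component_def Cov_poset_def)
qed

theorem theorem6p6:
  fixes L :: "('a, 'c) gorder_scheme"
  assumes "McKenzie_bounded_lattice L"
    and "\<gamma> \<in> Cov L"
  shows "McKenzie_bounded_lattice (Cov_component L \<gamma>)"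
proof -
  have lower: "lower_bounded_lattice L" and upper: "lower_bounded_lattice (inv_gorder L)"
    using assms(1) by (simp_all add: McKenzie_bounded_lattice_def upper_bounded_lattice_def)
  then have L: "lattice L" "finite (carrier L)" by (simp_all add: lower_bounded_lattice_def)
  note ranked = lower_bounded_imp_dependency_ranked[OF lower]
    lower_bounded_imp_dependency_ranked[OF upper]
  let ?K = "Cov_component L \<gamma>" and ?K' = "Cov_component (inv_gorder L) (prod.swap \<gamma>)"
  have K: "lattice ?K" "finite (carrier ?K)" "dependency_ranked ?K"
    using Cov_component_dependency_ranked[OF L ranked assms(2)] by simp_all
  have "\<gamma> \<in> carrier ?K" using assms(2) by (simp add: Cov_component_def)
  then have ne: "carrier ?K \<noteq> {}" by blast
  interpret L: lattice L by (rule L)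
  interpret L': lattice "inv_gorder L" using L(1) by (rule lattice_inv_gorder)
  have "prod.swap \<gamma> \<in> Cov (inv_gorder L)"
    using assms(2) unfolding L.Cov_iff L'.Cov_iff by auto
  \<comment> \<open>The double dual loses the extension fields of \<open>L\<close>, so it is not
    literally \<open>L\<close>; a rank reads only \<open>carrier\<close> and \<open>le\<close> and
    carries over.\<close>
  moreover have "dependency_ranked (inv_gorder (inv_gorder L))"
    using ranked(1)
    by (simp add: dependency_ranked_def dependency_rank_def down_arrow_def up_arrow_def)
  ultimately have "dependency_ranked ?K'"
    using Cov_component_dependency_ranked[OF L'.lattice_axioms _ ranked(2)] L(2) by simp
  \<comment> \<open>The dual of the component is isomorphic to the component of the swapped cover in
    the dual lattice.\<close>
  then have "dependency_ranked (inv_gorder ?K)"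
    by (rule dependency_ranked_iso[where h = prod.swap])
      (use Cov_component_inv_gorder[OF L(1)] in simp_all)
  then have "lower_bounded_lattice (inv_gorder ?K)"
    using K ne by (intro dependency_ranked_imp_lower_bounded lattice_inv_gorder) simp_all
  moreover have "lower_bounded_lattice ?K"
    by (rule dependency_ranked_imp_lower_bounded[OF K(1,2) ne K(3)])
  ultimately show ?thesis
    by (simp add: McKenzie_bounded_lattice_def upper_bounded_lattice_def)
qed

end
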